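(* Let $t$ be a positive integer. (1) For all $n\ge k\ge1$, $S_t(n,k)$ equals the number of ordered $t$-tuples $(\pi_1,\ldots,\pi_t)$ of set partitions of $[n]$ into $k$ blocks such that the sets of block minima of $\pi_1,\ldots,\pi_t$ coincide. (2) For all $n\ge k\ge1$, $s_t(n,k)$ equals the number of ordered $t$-tuples $(\sigma_1,\ldots,\sigma_t)$ of permutations of $[n]$ each having $k$ cycles such that the sets of cycle minima of $\sigma_1,\ldots,\sigma_t$ coincide. (3) For $n\ge0$ and every positive integer $m$, $B_{\mathbf{t}n}(m)=S_t(n+m,m)$ and $b_{\mathbf{t}n}(m)=s_t(m,m-n)$. (4) For positive integers $n,k$, $$S_t(n+k,k)=\sum_{1\le i_1\le\cdots\le i_n\le k} i_1^t\cdots i_n^t,\qquad s_t(n,n-k)=\sum_{1\le i_1<\cdots<i_k<n} i_1^t\cdots i_k^t.$$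
   Context: For a positive integer $t$, the numbers $S_t(n,k)$, $s_t(n,k)$ ($0\le k\le n$) are defined by $x^n=\sum_{k=0}^n S_t(n,k)\prod_{i=0}^{k-1}(x-i^t)$ and $\prod_{i=0}^{n-1}(x+i^t)=\sum_{k=0}^n s_t(n,k)x^k$ (and are $0$ for $k>n$ or negative arguments). $\mathbf{t}n$ denotes the $nt$-tuple consisting of $n$ consecutive blocks $(1,1,\ldots,1,2)$, each block having $t$ entries ($t-1$ ones followed by a $2$). Stirling polynomials: for a tuple $\mathbf{k}=(k_1,\ldots,k_N)$ of positive integers, $K=\sum k_i$, a Stirling permutation of $\{1^{k_1},\ldots,N^{k_N}\}$ is a word $\sigma(1)\cdots\sigma(K)$ with each $i$ appearing $k_i$ times such that $\sigma(i)=\sigma(j)$, $i<s<j$ imply $\sigma(s)\ge\sigma(i)$; index $i$ is a descent if $i<K$ and $\sigma(i)>\sigma(i+1)$, or $i=K$; $A_{\mathbf{k},i}$ counts those with exactly $i$ descents; $\sum_{m\ge0}B_{\mathbf{k}}(m)x^m=\frac{\sum_{i=1}^{N}A_{\mathbf{k},i}x^i}{(1-x)^{K+1}}$, $\sum_{m\ge0}b_{\mathbf{k}}(m)x^m=\frac{\sum_{i=K-N+1}^{K}A_{\mathbf{k},K+1-i}x^i}{(1-x)^{K+1}}$; for the empty tuple $B_\emptyset=b_\emptyset=1$. *)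

theory Defs
  imports
    "HOL-Computational_Algebra.Formal_Power_Series"
    "HOL-Computational_Algebra.Polynomial"
    "HOL-Combinatorics.Combinatorics"
    "HOL-Library.Disjoint_Sets"
begin

definition falling_poly :: "nat \<Rightarrow> nat \<Rightarrow> int poly" where
  "falling_poly t k = (\<Prod>i<k. [:- (int i ^ t), 1:])"

definition rising_poly :: "nat \<Rightarrow> nat \<Rightarrow> int poly" where
  "rising_poly t n = (\<Prod>i<n. [:int i ^ t, 1:])"

definition is_gen_stirling2 :: "nat \<Rightarrow> (int \<Rightarrow> int \<Rightarrow> int) \<Rightarrow> bool" where
  "is_gen_stirling2 t S \<longleftrightarrow>
     (\<forall>n k. n < 0 \<or> k < 0 \<or> n < k \<longrightarrow> S n k = 0) \<and>
     (\<forall>n::nat. monom 1 n = (\<Sum>k\<le>n. smult (S (int n) (int k)) (falling_poly t k)))"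

definition gen_stirling2 :: "nat \<Rightarrow> int \<Rightarrow> int \<Rightarrow> int" where
  "gen_stirling2 t = (THE S. is_gen_stirling2 t S)"

definition gen_stirling1 :: "nat \<Rightarrow> int \<Rightarrow> int \<Rightarrow> int" where
  "gen_stirling1 t n k =
     (if n < 0 \<or> k < 0 then 0 else coeff (rising_poly t (nat n)) (nat k))"

definition same_min_partitions :: "nat \<Rightarrow> nat \<Rightarrow> nat \<Rightarrow> nat set set list set" where
  "same_min_partitions t n k =
     {ps. length ps = t \<and>
          (\<forall>P\<in>set ps. partition_on {1..n} P \<and> card P = k) \<and>
          (\<forall>P\<in>set ps. \<forall>Q\<in>set ps. Min ` P = Min ` Q)}"

text \<open>Fixed points count as cycles of length one.\<close>
definition cycles_on :: "'a set \<Rightarrow> ('a \<Rightarrow> 'a) \<Rightarrow> 'a set set" where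
  "cycles_on A p = orbit p ` A"

definition same_min_permutations :: "nat \<Rightarrow> nat \<Rightarrow> nat \<Rightarrow> (nat \<Rightarrow> nat) list set" where
  "same_min_permutations t n k =
     {ps. length ps = t \<and>
          (\<forall>p\<in>set ps. p permutes {1..n} \<and> card (cycles_on {1..n} p) = k) \<and>
          (\<forall>p\<in>set ps. \<forall>q\<in>set ps.
             Min ` cycles_on {1..n} p = Min ` cycles_on {1..n} q)}"

text \<open>
  Letters and positions are numbered from 1 in the mathematics, while list positions start
  at 0: letter \<open>i\<close> has multiplicity \<open>ks ! (i - 1)\<close>, and \<open>\<sigma>(i)\<close> is \<open>w ! (i - 1)\<close>.
\<close>
definition stirling_perms :: "nat list \<Rightarrow> nat list set" where
  "stirling_perms ks =
     {w. set w \<subseteq> {1..length ks} \<and>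
         (\<forall>i\<in>{1..length ks}. count_list w i = ks ! (i - 1)) \<and>
         (\<forall>i s j. i < s \<and> s < j \<and> j < length w \<and> w ! i = w ! j \<longrightarrow> w ! i \<le> w ! s)}"

definition descents :: "nat list \<Rightarrow> nat set" where
  "descents w = {i\<in>{1..length w}. i = length w \<or> w ! (i - 1) > w ! i}"

definition eulerian_count :: "nat list \<Rightarrow> nat \<Rightarrow> nat" where
  "eulerian_count ks i = card {w \<in> stirling_perms ks. card (descents w) = i}"

definition stirling_poly_B :: "nat list \<Rightarrow> nat \<Rightarrow> rat" where
  "stirling_poly_B ks m =
     (if ks = [] then 1
      else fps_nth ((\<Sum>i=1..length ks. of_nat (eulerian_count ks i) * fps_X ^ i)
                      / (1 - fps_X) ^ (sum_list ks + 1)) m)"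

definition stirling_poly_b :: "nat list \<Rightarrow> nat \<Rightarrow> rat" where
  "stirling_poly_b ks m =
     (if ks = [] then 1
      else fps_nth ((\<Sum>i=sum_list ks - length ks + 1..sum_list ks.
                        of_nat (eulerian_count ks (sum_list ks + 1 - i)) * fps_X ^ i)
                      / (1 - fps_X) ^ (sum_list ks + 1)) m)"

definition block_tuple :: "nat \<Rightarrow> nat \<Rightarrow> nat list" where
  "block_tuple t n = concat (replicate n (replicate (t - 1) 1 @ [2]))"


lemma falling_poly_monic: "degree (falling_poly t k) = k \<and> coeff (falling_poly t k) k = 1"
proof (induction k)
  case 0
  show ?case by (simp add: falling_poly_def)
next
  case (Suc k)
  have eq: "falling_poly t (Suc k) = [:- (int k ^ t), 1:] * falling_poly t k"
    by (simp add: falling_poly_def mult.commute)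
  have nz: "falling_poly t k \<noteq> 0" using Suc by auto
  have "degree (falling_poly t (Suc k)) = Suc k"
    unfolding eq using Suc nz by (subst degree_mult_eq) auto
  moreover have "coeff (falling_poly t (Suc k)) (Suc k) = 1"
    unfolding eq using Suc by (simp add: coeff_eq_0)
  ultimately show ?case by simp
qed

lemma falling_poly_span:
  "degree p \<le> n \<Longrightarrow> \<exists>c. p = (\<Sum>k\<le>n. smult (c k) (falling_poly t k))"
proof (induction n arbitrary: p)
  case 0
  then obtain a where "p = [:a:]" by (metis degree_eq_zeroE le_zero_eq)
  then show ?case by (intro exI[of _ "\<lambda>_. a"]) (simp add: falling_poly_def)
next
  case (Suc n)
  let ?a = "coeff p (Suc n)"
  let ?r = "p - smult ?a (falling_poly t (Suc n))"
  have "degree ?r \<le> n"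
  proof (rule degree_le, intro allI impI)
    fix i assume "n < i"
    then consider "i = Suc n" | "Suc n < i" by linarith
    then show "coeff ?r i = 0"
      using Suc.prems falling_poly_monic[of t "Suc n"] by cases (auto simp: coeff_eq_0)
  qed
  from Suc.IH[OF this] obtain c where c: "?r = (\<Sum>k\<le>n. smult (c k) (falling_poly t k))"
    by blast
  have "p = ?r + smult ?a (falling_poly t (Suc n))" by simp
  also have "\<dots> = (\<Sum>k\<le>Suc n. smult ((c(Suc n := ?a)) k) (falling_poly t k))"
    unfolding c by simp
  finally show ?case by blast
qed

lemma falling_poly_indep:
  "(\<Sum>k\<le>n. smult (c k) (falling_poly t k)) = 0 \<Longrightarrow> k \<le> n \<Longrightarrow> c k = 0"
proof (induction n)
  case 0
  then show ?case by (simp add: falling_poly_def)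
next
  case (Suc n)
  have "coeff (\<Sum>k\<le>Suc n. smult (c k) (falling_poly t k)) (Suc n) = c (Suc n)"
    using falling_poly_monic[of t] by (simp add: coeff_sum coeff_eq_0)
  then have "c (Suc n) = 0" using Suc.prems(1) by (metis coeff_0)
  with Suc show ?case by (cases "k = Suc n") auto
qed

lemma gen_stirling2_ex1: "\<exists>!S. is_gen_stirling2 t S"
proof (rule ex_ex1I)
  have "\<forall>n. \<exists>c. monom 1 n = (\<Sum>k\<le>n. smult (c k) (falling_poly t k))"
    by (auto intro: falling_poly_span degree_monom_le)
  then obtain C where C: "\<And>n. monom 1 n = (\<Sum>k\<le>n. smult (C n k) (falling_poly t k))"
    by metis
  have "is_gen_stirling2 t
          (\<lambda>n k. if n < 0 \<or> k < 0 \<or> n < k then 0 else C (nat n) (nat k))"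
    unfolding is_gen_stirling2_def using C by (auto intro!: sum.cong)
  then show "\<exists>S. is_gen_stirling2 t S" by blast
next
  fix S T assume S: "is_gen_stirling2 t S" and T: "is_gen_stirling2 t T"
  show "S = T"
  proof (intro ext)
    fix n k
    show "S n k = T n k"
    proof (cases "n < 0 \<or> k < 0 \<or> n < k")
      case True
      then show ?thesis using S T by (auto simp: is_gen_stirling2_def)
    next
      case False
      then obtain n' k' where nk: "n = int n'" "k = int k'" "k' \<le> n'"
        by (metis nonneg_int_cases not_less of_nat_le_iff)
      have "(\<Sum>j\<le>n'. smult (S (int n') (int j) - T (int n') (int j)) (falling_poly t j))
              = monom 1 n' - monom 1 n'"
        using S T unfolding is_gen_stirling2_def
        by (simp add: smult_diff_left sum_subtractf)
      from falling_poly_indep[of "\<lambda>j. S (int n') (int j) - T (int n') (int j)" t n' k'] this nk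
      show ?thesis by simp
    qed
  qed
qed

lemma gen_stirling2_is: "is_gen_stirling2 t (gen_stirling2 t)"
  unfolding gen_stirling2_def by (rule theI'[OF gen_stirling2_ex1])

lemma rising_poly_degree: "degree (rising_poly t n) \<le> n"
  unfolding rising_poly_def
  by (rule order.trans[OF degree_prod_sum_le]) auto

lemma gen_stirling1_rising:
  "rising_poly t n = (\<Sum>k\<le>n. smult (gen_stirling1 t (int n) (int k)) (monom 1 k))"
  using poly_as_sum_of_monoms'[OF rising_poly_degree[of t n]]
  by (simp add: gen_stirling1_def smult_monom)

lemma gen_stirling1_eq_0: "n < 0 \<or> k < 0 \<or> n < k \<Longrightarrow> gen_stirling1 t n k = 0"
  using rising_poly_degree[of t "nat n"] by (auto simp: gen_stirling1_def intro!: coeff_eq_0)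

end

theory Submission
  imports Defs
begin

text \<open>
  Both number families are triangles \<open>a(n+1,k) = a(n,k-1) + c(n,k)\<^sup>t a(n,k)\<close>, with \<open>c(n,k) = k\<close>
  for \<open>S\<^sub>t\<close> and \<open>c(n,k) = n\<close> for \<open>s\<^sub>t\<close>. The symmetric function formulas follow by splitting
  off the largest index. For the tuples, fix the common set \<open>M\<close> of minima: adding the point \<open>n+1\<close>
  to a single object either makes it a new minimum, in one way, or attaches it to an
  existing object in \<open>c(n,|M|)\<close> ways, and the \<open>t\<close> components are independent once \<open>M\<close> is fixed.

  For the Stirling polynomials, insert a run of \<open>k\<close> copies of a new largest letter into a Stirling
  permutation of length \<open>K\<close>. The number of descents is kept at descent positions and grows by one
  at the other positions among the \<open>K + 1\<close> possible ones, so with \<open>G(x) = A(x) / (1-x)\<^bsup>K+1\<^esup>\<close> the new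
  generating function is \<open>x G'(x) / (1-x)\<^bsup>k-1\<^esup>\<close>. Hence \<open>k = 1\<close> multiplies the polynomial by \<open>m\<close> and
  \<open>k = 2\<close> in addition sums over \<open>j \<le> m\<close> (over \<open>j < m\<close> for the reversed numerators), and a whole block
  \<open>(1,...,1,2)\<close> reproduces the recursions of the two triangles.
\<close>

subsection \<open>Triangular recursions\<close>

text \<open>The weight \<open>c\<close> stays general so that \<open>k ^ t\<close> for partitions
  and \<open>n ^ t\<close> for permutations share one induction over the sets of minima.\<close>

fun triangle :: "(nat \<Rightarrow> nat \<Rightarrow> nat) \<Rightarrow> nat \<Rightarrow> nat \<Rightarrow> nat" where
  "triangle c 0 0 = 1"
| "triangle c 0 (Suc k) = 0"
| "triangle c (Suc n) 0 = c n 0 * triangle c n 0"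
| "triangle c (Suc n) (Suc k) = triangle c n k + c n (Suc k) * triangle c n (Suc k)"

lemma triangle_eq_0: "n < k \<Longrightarrow> triangle c n k = 0"
  by (induction c n k rule: triangle.induct) auto

text \<open>This is \<open>x = (x - k^t) + k^t\<close>, which turns multiplication by
  \<open>x\<close> into the two terms of the recursion.\<close>

lemma falling_poly_Suc:
  "monom 1 1 * falling_poly t k = falling_poly t (Suc k) + smult (int (k ^ t)) (falling_poly t k)"
  by (simp add: falling_poly_def monom_Suc algebra_simps smult_diff_left pCons_one)

lemma monom_eq_sum_triangle:
  "monom 1 n = (\<Sum>k\<le>n. smult (int (triangle (\<lambda>_ k. k ^ t) n k)) (falling_poly t k))"
proof (induction n)
  case 0
  show ?case by (simp add: falling_poly_def)
next
  case (Suc n)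
  let ?T = "triangle (\<lambda>_ k. k ^ t)"
  let ?f = "falling_poly t"
  have "monom (1::int) (Suc n) = monom 1 1 * monom 1 n"
    by (simp add: mult_monom)
  also have "\<dots> = (\<Sum>k\<le>n. smult (int (?T n k)) (monom 1 1 * ?f k))"
    by (simp add: Suc sum_distrib_left)
  also have "\<dots> = (\<Sum>k\<le>n. smult (int (?T n k)) (?f (Suc k)))
      + (\<Sum>k\<le>n. smult (int (k ^ t * ?T n k)) (?f k))"
    unfolding falling_poly_Suc by (simp add: smult_add_right sum.distrib mult.commute)
  \<comment> \<open>The added term is zero because \<open>?T n (Suc n) = 0\<close>. The longer range
    lets the index shift line this sum up with the one over \<open>?f (Suc k)\<close>.\<close>
  also have "(\<Sum>k\<le>n. smult (int (k ^ t * ?T n k)) (?f k))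
      = (\<Sum>k\<le>Suc n. smult (int (k ^ t * ?T n k)) (?f k))"
    by (simp add: triangle_eq_0)
  also have "\<dots> = smult (int (0 ^ t * ?T n 0)) (?f 0)
      + (\<Sum>k\<le>n. smult (int (Suc k ^ t * ?T n (Suc k))) (?f (Suc k)))"
    by (rule sum.atMost_Suc_shift)
  finally have "monom 1 (Suc n) = smult (int (0 ^ t * ?T n 0)) (?f 0)
      + (\<Sum>k\<le>n. smult (int (?T (Suc n) (Suc k))) (?f (Suc k)))"
    by (simp add: smult_add_left sum.distrib algebra_simps)
  then show ?case by (subst sum.atMost_Suc_shift) simp
qed

text \<open>The left side is known only through a definite description, so the triangle, extended by
  zero to all integers, is shown to meet the specification, and uniqueness does the rest.\<close>

lemma gen_stirling2_eq_triangle: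
  "gen_stirling2 t (int n) (int k) = int (triangle (\<lambda>_ k. k ^ t) n k)"
proof -
  let ?S = "\<lambda>n k. if n < 0 \<or> k < 0 \<or> n < k then 0 else int (triangle (\<lambda>_ k. k ^ t) (nat n) (nat k))"
  have "is_gen_stirling2 t ?S"
    unfolding is_gen_stirling2_def
  proof (intro conjI allI)
    fix n :: nat
    have "(\<Sum>k\<le>n. smult (?S (int n) (int k)) (falling_poly t k))
        = (\<Sum>k\<le>n. smult (int (triangle (\<lambda>_ k. k ^ t) n k)) (falling_poly t k))"
      by (rule sum.cong) auto
    then show "monom 1 n = (\<Sum>k\<le>n. smult (?S (int n) (int k)) (falling_poly t k))"
      using monom_eq_sum_triangle[of n t] by simp
  qed auto
  with gen_stirling2_is[of t] have "gen_stirling2 t = ?S"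
    using gen_stirling2_ex1 by blast
  then show ?thesis by (simp add: triangle_eq_0)
qed

text \<open>Compare coefficients after multiplying the rising polynomial by \<open>x + n^t\<close>.
  With an integer index \<open>k\<close>, the zeros at negative arguments supply the missing term
  for \<open>k = 0\<close>.\<close>

lemma gen_stirling1_Suc:
  "gen_stirling1 t (int (Suc n)) k =
     gen_stirling1 t (int n) (k - 1) + int (n ^ t) * gen_stirling1 t (int n) k"
proof -
  have r: "rising_poly t (Suc n) = pCons 0 (rising_poly t n) + smult (int (n ^ t)) (rising_poly t n)"
    by (simp add: rising_poly_def mult.commute[of _ "[:_, _:]"] add.commute)
  consider "k < 0" | "k = 0" | j where "k = int j + 1"
  proof -
    have "k = int (nat (k - 1)) + 1" if "k > 0" using that by simp
    then show ?thesis using that by (meson linorder_cases)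
  qed
  then show ?thesis
    by cases (auto simp: gen_stirling1_def r nat_add_distrib)
qed

lemma gen_stirling1_eq_triangle:
  "gen_stirling1 t (int n) (int k) = int (triangle (\<lambda>n _. n ^ t) n k)"
proof (induction n arbitrary: k)
  case 0
  show ?case by (cases k) (simp_all add: gen_stirling1_def rising_poly_def)
next
  case (Suc n)
  show ?case
  proof (cases k)
    case 0
    have "gen_stirling1 t (int n) (-1) = 0" by (simp add: gen_stirling1_def)
    with 0 Suc[of 0] show ?thesis by (simp add: gen_stirling1_Suc del: of_nat_Suc)
  next
    case (Suc j)
    then have "int k - 1 = int j" by simp
    with Suc Suc.IH[of j] Suc.IH[of k] show ?thesis
      by (simp only: gen_stirling1_Suc triangle.simps of_nat_add of_nat_mult)
  qed
qed

lemma gen_stirling1_diag: "gen_stirling1 t (int n) (int n) = 1"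
proof (induction n)
  case 0
  show ?case by (simp add: gen_stirling1_def rising_poly_def)
next
  case (Suc n)
  have "gen_stirling1 t (int n) (int (Suc n)) = 0" by (intro gen_stirling1_eq_0) simp
  with Suc show ?case by (simp only: gen_stirling1_Suc) simp
qed

text \<open>The triangle is reparametrised by the excess of the row over the column, which is the
  degree of the symmetric function and the number of blocks of the tuple.\<close>

lemma gen_stirling2_column:
  shows "gen_stirling2 t (int m) (int m) = 1"
    and "t \<ge> 1 \<Longrightarrow> gen_stirling2 t (int (Suc n)) 0 = 0"
    and "gen_stirling2 t (int (Suc n) + int (Suc m)) (int (Suc m)) =
           gen_stirling2 t (int (Suc n) + int m) (int m)
           + int (Suc m ^ t) * gen_stirling2 t (int n + int (Suc m)) (int (Suc m))"
proof -
  have "triangle (\<lambda>_ k. k ^ t) m m = 1" by (induction m) (auto simp: triangle_eq_0)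
  then show "gen_stirling2 t (int m) (int m) = 1" by (simp add: gen_stirling2_eq_triangle)
  show "gen_stirling2 t (int (Suc n)) 0 = 0" if "t \<ge> 1"
    using that gen_stirling2_eq_triangle[of t "Suc n" 0] by simp
  show "gen_stirling2 t (int (Suc n) + int (Suc m)) (int (Suc m)) =
           gen_stirling2 t (int (Suc n) + int m) (int m)
           + int (Suc m ^ t) * gen_stirling2 t (int n + int (Suc m)) (int (Suc m))"
    unfolding of_nat_add[symmetric] gen_stirling2_eq_triangle by simp
qed

subsection \<open>Sums over sorted lists\<close>

text \<open>\<open>h n k\<close> is the complete homogeneous symmetric function of degree
  \<open>n\<close> in \<open>f 1, ..., f k\<close>. Either the last entry is \<open>Suc k\<close>
  and is removed, or all entries are at most \<open>k\<close>.\<close>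

lemma sum_sorted_lists:
  fixes f :: "nat \<Rightarrow> 'a::comm_semiring_1"
  defines "A \<equiv> \<lambda>n k. {js. length js = n \<and> sorted js \<and> set js \<subseteq> {1..k}}"
  defines "h \<equiv> \<lambda>n k. \<Sum>js\<in>A n k. \<Prod>j\<leftarrow>js. f j"
  shows "h 0 k = 1" and "h (Suc n) 0 = 0"
    and "h (Suc n) (Suc k) = h (Suc n) k + f (Suc k) * h n (Suc k)"
proof -
  have "A 0 k = {[]}" by (auto simp: A_def)
  then show "h 0 k = 1" by (simp add: h_def)
  have "A (Suc n) 0 = {}" by (auto simp: A_def)
  then show "h (Suc n) 0 = 0" by (simp add: h_def)
  have fin: "finite (A n k)" for n k
    unfolding A_def by (rule finite_subset[OF _ finite_lists_length_eq[of "{1..k}" n]]) auto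
  have split: "A (Suc n) (Suc k) = A (Suc n) k \<union> (\<lambda>js. js @ [Suc k]) ` A n (Suc k)"
  proof (intro equalityI subsetI)
    fix js assume js: "js \<in> A (Suc n) (Suc k)"
    then obtain us l where eq: "js = us @ [l]" by (cases js rule: rev_cases) (auto simp: A_def)
    show "js \<in> A (Suc n) k \<union> (\<lambda>js. js @ [Suc k]) ` A n (Suc k)"
    proof (cases "l = Suc k")
      case True
      with js eq show ?thesis by (auto simp: A_def sorted_append)
    next
      case False
      with js eq have "js \<in> A (Suc n) k"
        by (force simp: A_def sorted_append)
      then show ?thesis by blast
    qed
  qed (force simp: A_def sorted_append)
  have "A (Suc n) k \<inter> (\<lambda>js. js @ [Suc k]) ` A n (Suc k) = {}" by (auto simp: A_def)
  then have "h (Suc n) (Suc k)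
      = h (Suc n) k + (\<Sum>js\<in>(\<lambda>js. js @ [Suc k]) ` A n (Suc k). \<Prod>j\<leftarrow>js. f j)"
    unfolding h_def split using fin by (intro sum.union_disjoint) auto
  also have "(\<Sum>js\<in>(\<lambda>js. js @ [Suc k]) ` A n (Suc k). \<Prod>j\<leftarrow>js. f j) = f (Suc k) * h n (Suc k)"
    by (subst sum.reindex) (auto simp: inj_on_def h_def sum_distrib_left mult.commute)
  finally show "h (Suc n) (Suc k) = h (Suc n) k + f (Suc k) * h n (Suc k)" .
qed

text \<open>\<open>e k n\<close> is the elementary symmetric function of degree \<open>k\<close> in
  \<open>f 1, ..., f (n - 1)\<close>. Passing to \<open>Suc n\<close> admits the new entry
  \<open>n\<close>, which can only come last, and only once.\<close>

lemma sum_strictly_sorted_lists: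
  fixes f :: "nat \<Rightarrow> 'a::comm_semiring_1"
  defines "A \<equiv> \<lambda>k n. {js. length js = k \<and> sorted_wrt (<) js \<and> set js \<subseteq> {1..<n}}"
  defines "e \<equiv> \<lambda>k n. \<Sum>js\<in>A k n. \<Prod>j\<leftarrow>js. f j"
  shows "e 0 n = 1" and "n \<le> 1 \<Longrightarrow> e (Suc k) n = 0"
    and "n \<ge> 1 \<Longrightarrow> e (Suc k) (Suc n) = e (Suc k) n + f n * e k n"
proof -
  have "A 0 n = {[]}" by (auto simp: A_def)
  then show "e 0 n = 1" by (simp add: e_def)
  show "e (Suc k) n = 0" if "n \<le> 1"
  proof -
    have "A (Suc k) n = {}" using that by (auto simp: A_def)
    then show ?thesis by (simp add: e_def)
  qed
  have fin: "finite (A k n)" for n k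
    unfolding A_def by (rule finite_subset[OF _ finite_lists_length_eq[of "{1..<n}" k]]) auto
  assume n: "n \<ge> 1"
  have split: "A (Suc k) (Suc n) = A (Suc k) n \<union> (\<lambda>js. js @ [n]) ` A k n"
  proof (intro equalityI subsetI)
    fix js assume js: "js \<in> A (Suc k) (Suc n)"
    then obtain us l where eq: "js = us @ [l]" by (cases js rule: rev_cases) (auto simp: A_def)
    show "js \<in> A (Suc k) n \<union> (\<lambda>js. js @ [n]) ` A k n"
    proof (cases "l = n")
      case True
      with js eq show ?thesis by (fastforce simp: A_def sorted_wrt_append)
    next
      case False
      with js eq have "js \<in> A (Suc k) n"
        by (force simp: A_def sorted_wrt_append)
      then show ?thesis by blast
    qed
  next
    fix js assume "js \<in> A (Suc k) n \<union> (\<lambda>js. js @ [n]) ` A k n"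
    then show "js \<in> A (Suc k) (Suc n)"
      using n by (fastforce simp: A_def sorted_wrt_append)
  qed
  have "A (Suc k) n \<inter> (\<lambda>js. js @ [n]) ` A k n = {}" by (auto simp: A_def)
  then have "e (Suc k) (Suc n) = e (Suc k) n + (\<Sum>js\<in>(\<lambda>js. js @ [n]) ` A k n. \<Prod>j\<leftarrow>js. f j)"
    unfolding e_def split using fin by (intro sum.union_disjoint) auto
  also have "(\<Sum>js\<in>(\<lambda>js. js @ [n]) ` A k n. \<Prod>j\<leftarrow>js. f j) = f n * e k n"
    by (subst sum.reindex) (auto simp: inj_on_def e_def sum_distrib_left mult.commute)
  finally show "e (Suc k) (Suc n) = e (Suc k) n + f n * e k n" .
qed

text \<open>The recursion lowers either \<open>k\<close> or \<open>n\<close>, hence the inner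
  induction on \<open>k\<close> for fixed \<open>n\<close>.\<close>

lemma gen_stirling2_eq_sum_sorted:
  assumes "t \<ge> 1"
  shows "gen_stirling2 t (int n + int k) (int k) =
     (\<Sum>js | length js = n \<and> sorted js \<and> set js \<subseteq> {1..k}. \<Prod>j\<leftarrow>js. int j ^ t)"
proof (induction n arbitrary: k)
  case 0
  show ?case unfolding sum_sorted_lists(1) using gen_stirling2_column(1) by simp
next
  case (Suc n)
  note IH = this
  show ?case
  proof (induction k)
    case 0
    show ?case using gen_stirling2_column(2)[OF assms, of n] unfolding sum_sorted_lists(2) by simp
  next
    case (Suc k)
    show ?case
      unfolding gen_stirling2_column(3) sum_sorted_lists(3) Suc IH by simp
  qed
qed

lemma gen_stirling1_eq_sum_strictly_sorted:
  assumes "t \<ge> 1"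
  shows "gen_stirling1 t (int n) (int n - int k) =
     (\<Sum>js | length js = k \<and> sorted_wrt (<) js \<and> set js \<subseteq> {1..<n}. \<Prod>j\<leftarrow>js. int j ^ t)"
proof (induction n arbitrary: k)
  case 0
  show ?case
  proof (cases k)
    case 0
    show ?thesis unfolding 0 sum_strictly_sorted_lists(1) using gen_stirling1_diag[of t 0] by simp
  next
    case (Suc k')
    then show ?thesis
      using sum_strictly_sorted_lists(2)[where n = 0 and k = k' and f = "\<lambda>j. int j ^ t"] by (simp add: gen_stirling1_def)
  qed
next
  case (Suc n)
  note IH = this
  show ?case
  proof (cases k)
    case 0
    show ?thesis
      unfolding 0 sum_strictly_sorted_lists(1) using gen_stirling1_diag[of t "Suc n"] by simp
  next
    case (Suc k')
    have rec: "gen_stirling1 t (int (Suc n)) (int (Suc n) - int k) =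
        gen_stirling1 t (int n) (int n - int k)
        + int (n ^ t) * gen_stirling1 t (int n) (int n - int k')"
      unfolding gen_stirling1_Suc Suc by (simp add: algebra_simps)
    show ?thesis
    proof (cases "n = 0")
      \<comment> \<open>The sum recursion needs \<open>n \<ge> 1\<close>. Here both terms of
        \<open>rec\<close> vanish, one by its negative index, the other because
        \<open>0 ^ t = 0\<close>.\<close>
      case True
      then have le: "Suc n \<le> 1" by simp
      have "gen_stirling1 t (int (Suc n)) (int (Suc n) - int k) = 0"
        unfolding rec using True assms Suc by (simp add: gen_stirling1_def)
      then show ?thesis
        unfolding Suc sum_strictly_sorted_lists(2)[OF le] .
    next
      case False
      then have "1 \<le> n" by simp
      show ?thesis
        unfolding rec IH unfolding Suc sum_strictly_sorted_lists(3)[OF \<open>1 \<le> n\<close>] by simp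
    qed
  qed
qed

subsection \<open>Tuples with a common label\<close>

text \<open>Once the common label \<open>i\<close> is fixed, the \<open>t\<close> entries are chosen
  independently from the fibre over \<open>i\<close>.\<close>

lemma card_constant_label_lists:
  assumes "t \<ge> 1" "finite X" "finite I" "f ` X \<subseteq> I"
  shows "card {xs. length xs = t \<and> set xs \<subseteq> X \<and> (\<forall>x\<in>set xs. \<forall>y\<in>set xs. f x = f y)}
           = (\<Sum>i\<in>I. card {x \<in> X. f x = i} ^ t)"
proof -
  let ?L = "\<lambda>i. {xs. set xs \<subseteq> {x \<in> X. f x = i} \<and> length xs = t}"
  have "{xs. length xs = t \<and> set xs \<subseteq> X \<and> (\<forall>x\<in>set xs. \<forall>y\<in>set xs. f x = f y)} = (\<Union>i\<in>I. ?L i)"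
  proof (intro equalityI subsetI)
    fix xs assume xs: "xs \<in> {xs. length xs = t \<and> set xs \<subseteq> X \<and> (\<forall>x\<in>set xs. \<forall>y\<in>set xs. f x = f y)}"
    \<comment> \<open>A nonempty list determines its label; the empty list would belong to every
      class.\<close>
    then have "hd xs \<in> set xs" using assms(1) by (cases xs) auto
    with xs assms(4) have "f (hd xs) \<in> I" "xs \<in> ?L (f (hd xs))" by blast+
    then show "xs \<in> (\<Union>i\<in>I. ?L i)" by blast
  qed auto
  also have "card \<dots> = (\<Sum>i\<in>I. card (?L i))"
  proof (rule card_UN_disjoint)
    show "\<forall>i\<in>I. \<forall>j\<in>I. i \<noteq> j \<longrightarrow> ?L i \<inter> ?L j = {}"
    proof (intro ballI impI equals0I)
      fix i j xs assume "i \<noteq> j" "xs \<in> ?L i \<inter> ?L j"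
      moreover from this have "hd xs \<in> set xs" using assms(1) by (cases xs) auto
      ultimately show False by auto
    qed
  qed (use assms in \<open>auto intro: finite_lists_length_eq\<close>)
  also have "\<dots> = (\<Sum>i\<in>I. card {x \<in> X. f x = i} ^ t)"
    using assms(2) by (simp add: card_lists_length_eq)
  finally show ?thesis .
qed

text \<open>\<open>W n M\<close> stands for the number of objects on \<open>{1..n}\<close> with set
  of minima \<open>M\<close>. Sorting the sets \<open>M\<close> by whether they contain
  \<open>Suc n\<close> gives the recursion, and the power \<open>t\<close> of \<open>W\<close> turns
  the factor \<open>c\<close> into \<open>c ^ t\<close>.\<close>

lemma sum_power_eq_triangle:
  fixes W :: "nat \<Rightarrow> nat set \<Rightarrow> nat"
  assumes W0: "W 0 {} = 1"
    and W1: "\<And>n M. M \<subseteq> {1..n} \<Longrightarrow> W (Suc n) (insert (Suc n) M) = W n M"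
    and W2: "\<And>n M. M \<subseteq> {1..n} \<Longrightarrow> W (Suc n) M = c n (card M) * W n M"
  shows "(\<Sum>M | M \<subseteq> {1..n} \<and> card M = k. W n M ^ t) = triangle (\<lambda>n k. c n k ^ t) n k"
proof (induction n arbitrary: k)
  case 0
  have "{M. M \<subseteq> {1..0::nat} \<and> card M = k} = (if k = 0 then {{}} else {})" by auto
  then show ?case by (cases k) (simp_all add: W0)
next
  case (Suc n)
  let ?A = "\<lambda>n k. {M. M \<subseteq> {1..n::nat} \<and> card M = k}"
  have old: "(\<Sum>M\<in>?A n k. W (Suc n) M ^ t) = c n k ^ t * (\<Sum>M\<in>?A n k. W n M ^ t)" for k
    unfolding sum_distrib_left by (rule sum.cong) (auto simp: W2 power_mult_distrib)
  show ?case
  proof (cases k)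
    case 0
    have "?A (Suc n) 0 = {{}}" "?A n 0 = {{}}"
      by (auto simp: finite_subset card_eq_0_iff dest: finite_subset)
    with old[of 0] Suc.IH[of 0] 0 show ?thesis by simp
  next
    case (Suc j)
    have split: "?A (Suc n) k = ?A n k \<union> insert (Suc n) ` ?A n j"
    proof (intro equalityI subsetI)
      fix M assume M: "M \<in> ?A (Suc n) k"
      show "M \<in> ?A n k \<union> insert (Suc n) ` ?A n j"
      proof (cases "Suc n \<in> M")
        case True
        have "finite M" using M by (auto intro: finite_subset)
        then have "M - {Suc n} \<in> ?A n j" using M True Suc
          by (auto simp: card_Diff_singleton le_Suc_eq subset_iff)
        moreover have "M = insert (Suc n) (M - {Suc n})" using True by blast
        ultimately show ?thesis by blast
      next
        case False
        with M have "M \<subseteq> {1..n}" by (fastforce simp: le_Suc_eq)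
        with M show ?thesis by blast
      qed
    next
      fix M assume "M \<in> ?A n k \<union> insert (Suc n) ` ?A n j"
      then consider "M \<in> ?A n k" | N where "N \<in> ?A n j" "M = insert (Suc n) N" by blast
      then show "M \<in> ?A (Suc n) k"
      proof cases
        case 2
        then have "finite N" "Suc n \<notin> N" by (auto intro: finite_subset)
        with 2 Suc show ?thesis by auto
      qed auto
    qed
    have inj: "inj_on (insert (Suc n)) (?A n j)"
      by (rule inj_onI) (auto simp: subset_iff set_eq_iff; metis Suc_n_not_le_n)
    have "?A n k \<inter> insert (Suc n) ` ?A n j = {}" by auto
    then have "(\<Sum>M\<in>?A (Suc n) k. W (Suc n) M ^ t)
        = (\<Sum>M\<in>?A n k. W (Suc n) M ^ t) + (\<Sum>M\<in>insert (Suc n) ` ?A n j. W (Suc n) M ^ t)"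
      unfolding split by (intro sum.union_disjoint) auto
    also have "(\<Sum>M\<in>insert (Suc n) ` ?A n j. W (Suc n) M ^ t) = (\<Sum>M\<in>?A n j. W n M ^ t)"
      using inj by (subst sum.reindex) (auto intro!: sum.cong simp: W1)
    finally show ?thesis unfolding old Suc.IH by (simp add: Suc)
  qed
qed

subsection \<open>Partitions with prescribed block minima\<close>

text \<open>Distinct blocks are disjoint and cannot share their minimum. Hence the set of minima has
  as many elements as there are blocks.\<close>

lemma inj_on_Min_partition:
  fixes A :: "'a::linorder set"
  assumes "finite A" "partition_on A P"
  shows "inj_on Min P"
proof (rule inj_onI)
  fix B C assume BC: "B \<in> P" "C \<in> P" "Min B = Min C"
  have "finite X" "X \<noteq> {}" if "X \<in> P" for X
    using that assms partition_onD1[OF assms(2)] partition_onD3[OF assms(2)]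
    by (auto intro: finite_subset)
  with BC have "Min B \<in> B \<inter> C" by (metis IntI Min_in)
  with BC partition_onD2[OF assms(2)] show "B = C" by (auto simp: disjoint_def)
qed

text \<open>A partition is encoded by the function sending each point to the minimum of its block.\<close>
lemma card_partitions_with_minima:
  fixes A :: "'a::linorder set"
  assumes "finite A" "M \<subseteq> A"
  shows "card {P. partition_on A P \<and> Min ` P = M}
       = (\<Prod>j\<in>A - M. card {m \<in> M. m < j})"
proof -
  \<comment> \<open>A minimum must label itself, while any other point may join the block of any
    smaller minimum. These choices are independent, so the functions form a product.\<close>
  let ?T = "\<lambda>j. if j \<in> M then {j} else {m \<in> M. m < j}"
  define F where "F = (\<lambda>f. (\<lambda>m. {j \<in> A. f j = m}) ` M)"
  have fibre: "Min {j \<in> A. f j = m} = m" if "f \<in> Pi\<^sub>E A ?T" "m \<in> M" for f m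
  proof (rule Min_eqI)
    show "m \<in> {j \<in> A. f j = m}" using that assms by (auto simp: PiE_def Pi_def)
    show "m \<le> j" if "j \<in> {j \<in> A. f j = m}" for j
      using that \<open>f \<in> _\<close> by (force simp: PiE_def Pi_def split: if_splits)
  qed (use assms in auto)
  have "bij_betw F (Pi\<^sub>E A ?T) {P. partition_on A P \<and> Min ` P = M}"
    unfolding bij_betw_def
  proof (intro conjI equalityI subsetI)
    show "inj_on F (Pi\<^sub>E A ?T)"
    proof (rule inj_onI)
      fix f g assume f: "f \<in> Pi\<^sub>E A ?T" and g: "g \<in> Pi\<^sub>E A ?T" and eq: "F f = F g"
      have "f j = g j" if j: "j \<in> A" for j
      proof -
        have "f j \<in> M" using f j by (auto simp: PiE_def Pi_def split: if_splits)
        then have "{i \<in> A. f i = f j} \<in> F f" unfolding F_def by blast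
        then have "{i \<in> A. f i = f j} \<in> F g" unfolding eq .
        then obtain m where m: "m \<in> M" "{i \<in> A. f i = f j} = {i \<in> A. g i = m}"
          unfolding F_def by blast
        \<comment> \<open>Equal fibres have equal minima, and the minimum of a fibre is its
          label.\<close>
        then have "f j = m" using fibre[OF f \<open>f j \<in> M\<close>] fibre[OF g m(1)] by simp
        moreover have "j \<in> {i \<in> A. g i = m}" unfolding m(2)[symmetric] using j by simp
        ultimately show ?thesis by simp
      qed
      then show "f = g" using f g by (auto intro: PiE_ext)
    qed
  next
    fix P assume "P \<in> F ` Pi\<^sub>E A ?T"
    then obtain f where f: "f \<in> Pi\<^sub>E A ?T" and P: "P = F f" by blast
    have mem: "f j \<in> M" if "j \<in> A" for j using f that by (auto simp: PiE_def Pi_def split: if_splits)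
    have "m \<in> {j \<in> A. f j = m}" if "m \<in> M" for m
      using that assms f by (auto simp: PiE_def Pi_def)
    then have "partition_on A P"
      unfolding P F_def using mem by (intro partition_onI) (auto simp: disjnt_def)
    moreover have "Min ` P = M"
      unfolding P F_def using fibre[OF f] by (force simp: image_image)
    ultimately show "P \<in> {P. partition_on A P \<and> Min ` P = M}" by blast
  next
    fix P assume "P \<in> {P. partition_on A P \<and> Min ` P = M}"
    then have P: "partition_on A P" and M: "Min ` P = M" by auto
    have fin: "finite B" "B \<noteq> {}" "B \<subseteq> A" if "B \<in> P" for B
      using that assms partition_onD1[OF P] partition_onD3[OF P] by (auto intro: finite_subset)
    define b where "b = (\<lambda>j. THE B. B \<in> P \<and> j \<in> B)"
    have b: "b j = B" if "B \<in> P" "j \<in> B" for j B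
      unfolding b_def using that partition_onD2[OF P]
      by (intro the_equality) (auto simp: disjoint_def)
    have bP: "b j \<in> P" "j \<in> b j" if "j \<in> A" for j
      using that b partition_onD1[OF P] by auto
    define f where "f = restrict (\<lambda>j. Min (b j)) A"
    have MinB: "Min B \<in> B" if "B \<in> P" for B using fin[OF that] by simp
    have "f \<in> Pi\<^sub>E A ?T"
    proof (rule PiE_I)
      fix j assume j: "j \<in> A"
      show "f j \<in> ?T j"
      proof (cases "j \<in> M")
        case True
        then obtain B where B: "B \<in> P" "j = Min B" using M by blast
        then have "b j = B" using b MinB by blast
        with B True j show ?thesis by (simp add: f_def)
      next
        case False
        have "Min (b j) \<in> M" using bP[OF j] M by blast
        moreover have "Min (b j) \<le> j" using bP[OF j] fin by (intro Min_le) auto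
        ultimately show ?thesis using False j by (auto simp: f_def order.order_iff_strict)
      qed
    qed (simp add: f_def)
    moreover have "F f = P"
    proof -
      have "{j \<in> A. f j = Min B} = B" if B: "B \<in> P" for B
      proof (intro equalityI subsetI)
        fix j assume j: "j \<in> {j \<in> A. f j = Min B}"
        then have "Min (b j) = Min B" by (auto simp: f_def)
        with inj_on_Min_partition[OF assms(1) P] bP j B have "b j = B" by (auto dest: inj_onD)
        then show "j \<in> B" using bP j by blast
      next
        fix j assume "j \<in> B"
        then show "j \<in> {j \<in> A. f j = Min B}" using b[OF B] fin[OF B] by (auto simp: f_def)
      qed
      then show ?thesis unfolding F_def M[symmetric] by (force simp: image_image)
    qed
    ultimately show "P \<in> F ` Pi\<^sub>E A ?T" by blast
  qed
  then have "card {P. partition_on A P \<and> Min ` P = M} = card (Pi\<^sub>E A ?T)"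
    by (simp add: bij_betw_same_card)
  also have "\<dots> = (\<Prod>j\<in>A. card (?T j))" using assms by (simp add: card_PiE)
  \<comment> \<open>Points of \<open>M\<close> have one choice each and contribute the factor
    1.\<close>
  also have "\<dots> = (\<Prod>j\<in>A - M. card {m \<in> M. m < j})"
    using assms by (intro prod.mono_neutral_cong_right) auto
  finally show ?thesis .
qed

lemma card_same_min_partitions:
  assumes "t \<ge> 1"
  shows "card (same_min_partitions t n k) = triangle (\<lambda>_ k. k ^ t) n k"
proof -
  let ?X = "{P. partition_on {1..n} P \<and> card P = k}"
  let ?I = "{M. M \<subseteq> {1..n} \<and> card M = k}"
  let ?W = "\<lambda>n M. \<Prod>j\<in>{1..n} - M. card {m \<in> M. m < j}"
  have card_Min: "card (Min ` P) = card P" if "partition_on {1..n} P" for P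
    using inj_on_Min_partition[OF _ that] by (simp add: card_image)
  have sub: "Min ` P \<subseteq> {1..n}" if "partition_on {1..n} P" for P
  proof
    fix m assume "m \<in> Min ` P"
    then obtain B where B: "B \<in> P" "m = Min B" by blast
    then have "finite B" "B \<noteq> {}" "B \<subseteq> {1..n}"
      using partition_onD1[OF that] partition_onD3[OF that] by (auto intro: finite_subset)
    with B show "m \<in> {1..n}" using Min_in by blast
  qed
  have "same_min_partitions t n k =
      {ps. length ps = t \<and> set ps \<subseteq> ?X \<and> (\<forall>P\<in>set ps. \<forall>Q\<in>set ps. Min ` P = Min ` Q)}"
    unfolding same_min_partitions_def by blast
  also have "card \<dots> = (\<Sum>M\<in>?I. card {P \<in> ?X. Min ` P = M} ^ t)"
    using assms card_Min sub
    by (intro card_constant_label_lists)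
      (auto intro: finite_subset[OF _ finitely_many_partition_on[of "{1..n}"]])
  also have "\<dots> = (\<Sum>M\<in>?I. ?W n M ^ t)"
  proof (rule sum.cong)
    fix M assume M: "M \<in> ?I"
    then have "{P \<in> ?X. Min ` P = M} = {P. partition_on {1..n} P \<and> Min ` P = M}"
      using card_Min by auto
    then show "card {P \<in> ?X. Min ` P = M} ^ t = ?W n M ^ t"
      using card_partitions_with_minima[of "{1..n}" M] M by simp
  qed simp
  also have "\<dots> = triangle (\<lambda>_ k. k ^ t) n k"
  proof (rule sum_power_eq_triangle)
    fix n M assume M: "M \<subseteq> {1..n::nat}"
    \<comment> \<open>As a new minimum, \<open>Suc n\<close> brings no factor and lies below no old
      point.\<close>
    have "{1..Suc n} - insert (Suc n) M = {1..n} - M" by auto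
    moreover have "{m \<in> insert (Suc n) M. m < j} = {m \<in> M. m < j}" if "j \<le> n" for j
      using that by auto
    ultimately show "?W (Suc n) (insert (Suc n) M) = ?W n M" by simp
    \<comment> \<open>As a non-minimum, \<open>Suc n\<close> may join any of the
      \<open>card M\<close> blocks.\<close>
    have "{1..Suc n} - M = insert (Suc n) ({1..n} - M)" using M by auto
    moreover have "{m \<in> M. m < Suc n} = M" using M by auto
    ultimately show "?W (Suc n) M = card M * ?W n M" by simp
  qed simp
  finally show ?thesis .
qed

subsection \<open>Permutations with prescribed cycle minima\<close>

text \<open>The composition reroutes only the arrow of \<open>p\<close> into \<open>b\<close>: the
  predecessor of \<open>b\<close> now goes to \<open>a\<close>, and \<open>a\<close> goes to
  \<open>b\<close>. So each orbit changes at most by gaining \<open>a\<close>.\<close>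

lemma orbit_transpose_comp:
  assumes p: "p permutes S" and fin: "finite S" and a: "a \<notin> S" and b: "b \<in> S" and x: "x \<in> S"
  shows "orbit (transpose a b \<circ> p) x - {a} = orbit p x"
proof -
  let ?q = "transpose a b \<circ> p"
  have inS: "p y \<in> S" if "y \<in> S" for y using permutes_in_image[OF p] that by simp
  have qa: "?q a = b" using permutes_not_in[OF p a] by simp
  have q: "?q y = (if p y = b then a else p y)" if "y \<in> S" for y
    using inS[OF that] a by (auto simp: transpose_def)
  have orbS: "y \<in> S" if "y \<in> orbit p x" for y
    using permutes_orbit_subset[OF p x] that by blast
  have "y \<in> orbit p x \<or> y = a \<and> b \<in> orbit p x" if "y \<in> orbit ?q x" for y
    using that
  proof (induction rule: orbit.induct)
    case base
    show ?case using orbit.base[of p x] q[OF x] by auto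
  next
    case (step y)
    from step.IH show ?case
    proof
      assume y: "y \<in> orbit p x"
      then show ?thesis using q[OF orbS[OF y]] orbit.step[OF y] by auto
    qed (use qa in auto)
  qed
  moreover have "y \<in> orbit ?q x" if "y \<in> orbit p x" for y
  proof -
    \<comment> \<open>One arrow of \<open>p\<close> is one arrow of \<open>?q\<close>, or two arrows
      passing through \<open>a\<close>.\<close>
    have via: "p z \<in> orbit ?q x" if "?q z \<in> orbit ?q x" "z \<in> S" for z
      using orbit.step[OF that(1)] that(1) qa q[OF that(2)] by metis
    from that show ?thesis
      by (induction rule: orbit.induct) (use via orbS x orbit.base orbit.step in metis)+
  qed
  ultimately show ?thesis using a orbS by blast
qed

lemma permutes_orbit_eq:
  assumes "p permutes S" "finite S" "y \<in> orbit p x"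
  shows "orbit p y = orbit p x"
  using assms by (metis cyclic_on_orbit orbit_cyclic_eq3 permutation_permutes)

lemma permutes_orbit_finite_nonempty:
  assumes "p permutes S" "finite S" "x \<in> S"
  shows "finite (orbit p x)" "orbit p x \<noteq> {}" "orbit p x \<subseteq> S" "x \<in> orbit p x"
proof -
  show sub: "orbit p x \<subseteq> S" by (rule permutes_orbit_subset[OF assms(1,3)])
  show "finite (orbit p x)" by (rule finite_subset[OF sub assms(2)])
  have "permutation p" using assms(1,2) unfolding permutation_permutes by blast
  then show "x \<in> orbit p x" by (rule permutation_self_in_orbit)
  then show "orbit p x \<noteq> {}" by blast
qed

lemma card_Min_cycles:
  assumes "p permutes S" "finite S"
  shows "card (Min ` cycles_on S p) = card (cycles_on S p)"
proof (rule card_image, rule inj_onI)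
  fix B C assume BC: "B \<in> cycles_on S p" "C \<in> cycles_on S p" "Min B = Min C"
  then obtain x y where xy: "x \<in> S" "y \<in> S" "B = orbit p x" "C = orbit p y"
    by (auto simp: cycles_on_def)
  have "Min B \<in> orbit p x" "Min B \<in> orbit p y"
    using xy BC(3) permutes_orbit_finite_nonempty[OF assms] by (metis Min_in)+
  then show "B = C" using permutes_orbit_eq[OF assms] xy by metis
qed

lemma Min_cycles_subset:
  assumes "p permutes S" "finite S"
  shows "Min ` cycles_on S p \<subseteq> S"
proof
  fix m assume "m \<in> Min ` cycles_on S p"
  then obtain x where x: "x \<in> S" "m = Min (orbit p x)" by (auto simp: cycles_on_def)
  then show "m \<in> S" using permutes_orbit_finite_nonempty[OF assms x(1)] Min_in by blast
qed

lemma Min_cycles_fixpoint: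
  assumes p: "p permutes S" and a: "a \<notin> S"
  shows "Min ` cycles_on (insert a S) p = insert a (Min ` cycles_on S p)"
proof -
  have "orbit p a = {a}" using permutes_not_in[OF p a] by (simp add: orbit_eq_singleton_iff)
  then show ?thesis by (simp add: cycles_on_def)
qed

text \<open>Composition with the transposition inserts the maximum \<open>a\<close> into the cycle of \<open>b\<close>.\<close>
lemma Min_cycles_transpose_comp:
  assumes p: "p permutes S" and fin: "finite S" and a: "\<And>x. x \<in> S \<Longrightarrow> x < a" and b: "b \<in> S"
  shows "Min ` cycles_on (insert a S) (transpose a b \<circ> p) = Min ` cycles_on S p"
proof -
  let ?q = "transpose a b \<circ> p"
  have aS: "a \<notin> S" using a by blast
  have q: "?q permutes insert a S"
    using permutes_compose[OF permutes_subset[OF p] permutes_swap_id] b by blast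
  have fin': "finite (insert a S)" using fin by simp
  have eq: "Min (orbit ?q x) = Min (orbit p x)" if x: "x \<in> S" for x
  proof (rule Min_eqI)
    note o = permutes_orbit_finite_nonempty[OF p fin x]
    note d = orbit_transpose_comp[OF p fin aS b x]
    show "finite (orbit ?q x)" by (rule permutes_orbit_finite_nonempty[OF q fin']) (use x in simp)
    show "Min (orbit p x) \<in> orbit ?q x" using Min_in[OF o(1,2)] d by blast
    show "Min (orbit p x) \<le> y" if y: "y \<in> orbit ?q x" for y
    proof (cases "y = a")
      case True
      have "Min (orbit p x) \<in> S" using Min_in[OF o(1,2)] o(3) by blast
      with a True show ?thesis by (simp add: order_less_imp_le)
    next
      case False
      with y d have "y \<in> orbit p x" by blast
      with o(1) show ?thesis by simp
    qed
  qed
  \<comment> \<open>The new point lies on the cycle of \<open>b\<close>, so no cycle is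
    added.\<close>
  have "b = ?q a" using permutes_not_in[OF p aS] by simp
  then have "orbit ?q a = orbit ?q b"
    using permutes_orbit_eq[OF q fin'] orbit.base[of ?q a] by metis
  then have "orbit ?q ` insert a S = orbit ?q ` S" using b by auto
  then show ?thesis unfolding cycles_on_def by (simp add: image_image eq del: comp_apply)
qed

text \<open>A permutation of \<open>insert a S\<close> either fixes \<open>a\<close>, which creates
  the new minimum \<open>a\<close>, or is uniquely \<open>transpose a b \<circ> r\<close> with
  \<open>b\<close> in \<open>S\<close>, which keeps all minima because \<open>a\<close> is
  greatest.\<close>

lemma card_permutations_with_minima_insert:
  fixes S :: "'a::linorder set"
  assumes fin: "finite S" and a: "\<And>x. x \<in> S \<Longrightarrow> x < a" and M: "M \<subseteq> S"
  defines "W \<equiv> \<lambda>S M. card {p. p permutes S \<and> Min ` cycles_on S p = M}"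
  shows "W (insert a S) (insert a M) = W S M"
    and "W (insert a S) M = card S * W S M"
proof -
  have aS: "a \<notin> S" "a \<notin> M" using a M by auto
  let ?Q = "\<lambda>S M. {p. p permutes S \<and> Min ` cycles_on S p = M}"
  have dich: "p permutes insert a S \<longleftrightarrow>
      p permutes S \<or> (\<exists>b\<in>S. \<exists>r. r permutes S \<and> p = transpose a b \<circ> r)" for p
  proof -
    have "{p. p permutes insert a S} = {transpose a b \<circ> r |b r. b \<in> insert a S \<and> r permutes S}"
      unfolding permutes_insert by auto
    then have "p permutes insert a S \<longleftrightarrow> (\<exists>b\<in>insert a S. \<exists>r. r permutes S \<and> p = transpose a b \<circ> r)"
      by blast
    then show ?thesis by simp
  qed
  have Msub: "Min ` cycles_on S p \<subseteq> S" if "p permutes S" for p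
    by (rule Min_cycles_subset[OF that fin])
  have "?Q (insert a S) (insert a M) = ?Q S M"
  proof (intro equalityI subsetI)
    fix p assume p: "p \<in> ?Q (insert a S) (insert a M)"
    from p dich consider "p permutes S" | b r where "b \<in> S" "r permutes S" "p = transpose a b \<circ> r"
      by blast
    then show "p \<in> ?Q S M"
    proof cases
      case 1
      have "insert a (Min ` cycles_on S p) = insert a M"
        using p Min_cycles_fixpoint[OF 1 aS(1)] by simp
      moreover have "a \<notin> Min ` cycles_on S p" using Msub[OF 1] aS(1) by blast
      ultimately show ?thesis using 1 aS(2) by (simp add: insert_ident)
    next
      case 2
      have "insert a M = Min ` cycles_on S r"
        using p Min_cycles_transpose_comp[OF 2(2) fin a 2(1)] unfolding 2(3) by simp
      then have "insert a M \<subseteq> S" using Msub[OF 2(2)] by simp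
      then show ?thesis using aS by blast
    qed
  next
    fix p assume p: "p \<in> ?Q S M"
    then have "p permutes S" by simp
    with p show "p \<in> ?Q (insert a S) (insert a M)"
      using Min_cycles_fixpoint[OF _ aS(1), of p] dich[of p] by simp
  qed
  then show "W (insert a S) (insert a M) = W S M" by (simp add: W_def)
  let ?g = "\<lambda>(b, p). transpose a b \<circ> p"
  have "?Q (insert a S) M = ?g ` (S \<times> ?Q S M)"
  proof (intro equalityI subsetI)
    fix p assume p: "p \<in> ?Q (insert a S) M"
    from p dich consider "p permutes S" | b r where "b \<in> S" "r permutes S" "p = transpose a b \<circ> r"
      by blast
    then show "p \<in> ?g ` (S \<times> ?Q S M)"
    proof cases
      case 1
      have "insert a (Min ` cycles_on S p) = M"
        using p Min_cycles_fixpoint[OF 1 aS(1)] by simp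
      with aS(2) show ?thesis by blast
    next
      case 2
      have "r \<in> ?Q S M"
        using p Min_cycles_transpose_comp[OF 2(2) fin a 2(1)] 2(2) unfolding 2(3) by simp
      with 2 show ?thesis by force
    qed
  next
    fix p assume "p \<in> ?g ` (S \<times> ?Q S M)"
    then obtain b r where br: "b \<in> S" "r \<in> ?Q S M" "p = transpose a b \<circ> r" by auto
    then have r: "r permutes S" by simp
    have "p permutes insert a S" using dich r br by blast
    moreover have "Min ` cycles_on (insert a S) p = M"
      unfolding br(3) using Min_cycles_transpose_comp[OF r fin a br(1)] br(2) by simp
    ultimately show "p \<in> ?Q (insert a S) M" by simp
  qed
  moreover have "inj_on ?g (S \<times> ?Q S M)"
  proof (rule inj_onI, clarify)
    fix b r c s assume *: "r permutes S" "s permutes S" "transpose a b \<circ> r = transpose a c \<circ> s"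
    \<comment> \<open>Both \<open>r\<close> and \<open>s\<close> fix \<open>a\<close>, so evaluating
      at \<open>a\<close> recovers \<open>b\<close> and \<open>c\<close>; the transposition then
      cancels as an involution.\<close>
    have "transpose a b (r a) = transpose a c (s a)" using *(3) by (metis comp_apply)
    then have "b = c" using permutes_not_in[OF *(1) aS(1)] permutes_not_in[OF *(2) aS(1)] by simp
    have "r = transpose a b \<circ> (transpose a b \<circ> r)" by (simp flip: comp_assoc)
    also have "\<dots> = transpose a c \<circ> (transpose a c \<circ> s)" by (simp only: *(3) \<open>b = c\<close>[symmetric])
    also have "\<dots> = s" by (simp flip: comp_assoc)
    finally show "b = c \<and> r = s" using \<open>b = c\<close> by simp
  qed
  ultimately show "W (insert a S) M = card S * W S M"
    by (simp add: W_def card_image card_cartesian_product)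
qed

lemma card_same_min_permutations:
  assumes "t \<ge> 1"
  shows "card (same_min_permutations t n k) = triangle (\<lambda>n _. n ^ t) n k"
proof -
  let ?X = "{p. p permutes {1..n} \<and> card (cycles_on {1..n} p) = k}"
  let ?I = "{M. M \<subseteq> {1..n} \<and> card M = k}"
  let ?W = "\<lambda>n M. card {p. p permutes {1..n::nat} \<and> Min ` cycles_on {1..n} p = M}"
  have "same_min_permutations t n k = {ps. length ps = t \<and> set ps \<subseteq> ?X \<and>
      (\<forall>p\<in>set ps. \<forall>q\<in>set ps. Min ` cycles_on {1..n} p = Min ` cycles_on {1..n} q)}"
    (is "_ = ?L") unfolding same_min_permutations_def by blast
  then have "card (same_min_permutations t n k) = card ?L" by (rule arg_cong)
  also have "\<dots> = (\<Sum>M\<in>?I. card {p \<in> ?X. Min ` cycles_on {1..n} p = M} ^ t)"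
  proof (rule card_constant_label_lists[OF assms])
    show "finite ?X" by (rule finite_subset[OF _ finite_permutations[of "{1..n}"]]) auto
    show "(\<lambda>p. Min ` cycles_on {1..n} p) ` ?X \<subseteq> ?I"
    proof clarify
      fix p assume p: "p permutes {1..n}" "k = card (cycles_on {1..n} p)"
      show "Min ` cycles_on {1..n} p \<subseteq> {1..n} \<and>
          card (Min ` cycles_on {1..n} p) = card (cycles_on {1..n} p)"
        using Min_cycles_subset[OF p(1)] card_Min_cycles[OF p(1)] by simp
    qed
    show "finite ?I" by (rule finite_subset[of _ "Pow {1..n}"]) auto
  qed
  also have "\<dots> = (\<Sum>M\<in>?I. ?W n M ^ t)"
  proof (rule sum.cong)
    fix M assume M: "M \<in> ?I"
    have "card (cycles_on {1..n} p) = k"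
      if "p permutes {1..n}" "Min ` cycles_on {1..n} p = M" for p
      using card_Min_cycles[OF that(1)] that(2) M by simp
    then have "{p \<in> ?X. Min ` cycles_on {1..n} p = M} =
        {p. p permutes {1..n} \<and> Min ` cycles_on {1..n} p = M}"
      by blast
    then show "card {p \<in> ?X. Min ` cycles_on {1..n} p = M} ^ t = ?W n M ^ t" by (rule arg_cong)
  qed (rule refl)
  also have "\<dots> = triangle (\<lambda>n _. n ^ t) n k"
  proof (rule sum_power_eq_triangle)
    fix n M assume M: "M \<subseteq> {1..n::nat}"
    have ins: "{1..Suc n} = insert (Suc n) {1..n}" by auto
    show "?W (Suc n) (insert (Suc n) M) = ?W n M"
      unfolding ins by (rule card_permutations_with_minima_insert) (use M in auto)
    \<comment> \<open>The new point can be put directly before any of the \<open>n\<close> old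
      points, whatever \<open>M\<close> is. This yields the weight \<open>n ^ t\<close>.\<close>
    have "?W (Suc n) M = card {1..n} * ?W n M"
      unfolding ins by (rule card_permutations_with_minima_insert) (use M in auto)
    then show "?W (Suc n) M = n * ?W n M" by simp
  qed (simp add: cycles_on_def)
  finally show ?thesis .
qed

subsection \<open>Descents under insertion of a run\<close>

text \<open>Here \<open>p\<close> counts the letters before the run. With indices of
  \<open>descents\<close> starting at 1, the insertion breaks exactly the adjacency at index
  \<open>p\<close>.\<close>

definition insert_run :: "nat \<Rightarrow> 'a \<Rightarrow> nat \<Rightarrow> 'a list \<Rightarrow> 'a list" where
  "insert_run k a p w = take p w @ replicate k a @ drop p w"

lemma length_insert_run: "length (insert_run k a p w) = length w + k"
  by (simp add: insert_run_def)

lemma nth_insert_run: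
  assumes "p \<le> length w" "i < length w + k"
  shows "insert_run k a p w ! i = (if i < p then w ! i else if i < p + k then a else w ! (i - k))"
proof -
  consider "i < p" | "p \<le> i" "i < p + k" | "p + k \<le> i" by linarith
  then show ?thesis
  proof cases
    case 2
    then have "i - p < k" by simp
    with 2 assms show ?thesis by (simp add: insert_run_def nth_append)
  next
    case 3
    then have "\<not> i - p < k" by simp
    with 3 assms have "insert_run k a p w ! i = drop p w ! (i - p - k)"
      by (simp add: insert_run_def nth_append)
    also have "\<dots> = w ! (i - k)" using 3 assms by simp
    finally show ?thesis using 3 by simp
  qed (use assms in \<open>simp_all add: insert_run_def nth_append\<close>)
qed

lemma set_insert_run: "set (insert_run k a p w) = (if k = 0 then set w else insert a (set w))"
proof -
  have "set w = set (take p w) \<union> set (drop p w)" by (metis append_take_drop_id set_append)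
  then show ?thesis by (auto simp: insert_run_def)
qed

lemma count_list_insert_run:
  "count_list (insert_run k a p w) b = count_list w b + (if a = b then k else 0)"
proof -
  have "count_list w b = count_list (take p w) b + count_list (drop p w) b"
    by (metis append_take_drop_id count_list_append)
  moreover have "count_list (replicate k a) b = (if a = b then k else 0)"
    by (induction k) auto
  ultimately show ?thesis by (simp add: insert_run_def)
qed

lemma card_descents_Nil: "card (descents []) = 0"
  by (simp add: descents_def)

lemma card_descents_Cons:
  "card (descents (a # w)) = (if w = [] \<or> a > hd w then 1 else 0) + card (descents w)"
proof -
  have "descents (a # w) = (if w = [] \<or> a > hd w then {1} else {}) \<union> Suc ` descents w"
  proof (intro set_eqI)
    fix i
    show "i \<in> descents (a # w) \<longleftrightarrow>
        i \<in> (if w = [] \<or> a > hd w then {1} else {}) \<union> Suc ` descents w"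
    proof (cases i)
      case 0
      then show ?thesis by (auto simp: descents_def)
    next
      case (Suc j)
      then show ?thesis
        by (cases j; cases w) (auto simp: descents_def image_iff)
    qed
  qed
  moreover have "1 \<notin> Suc ` descents w" by (auto simp: descents_def)
  moreover have "finite (descents w)" by (simp add: descents_def)
  ultimately show ?thesis by (simp add: card_image)
qed

text \<open>The last index of \<open>u\<close> always counts as a descent of \<open>u\<close> alone,
  but in \<open>u @ v\<close> only if the letter drops there; the left side corrects for
  this.\<close>

lemma card_descents_append:
  "v \<noteq> [] \<Longrightarrow> card (descents (u @ v)) + (if u \<noteq> [] \<and> last u \<le> hd v then 1 else 0)
     = card (descents u) + card (descents v)"
proof (induction u)
  case (Cons a u)
  then show ?case by (cases u) (simp_all add: card_descents_Cons card_descents_Nil)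
qed (simp add: card_descents_Nil)

lemma card_descents_replicate: "k \<ge> 1 \<Longrightarrow> card (descents (replicate k a)) = 1"
proof (induction k rule: nat_induct_at_least)
  case base
  show ?case by (simp add: card_descents_Cons card_descents_Nil)
next
  case (Suc k)
  then show ?case by (cases k) (simp_all add: card_descents_Cons)
qed

lemma descents_subset: "descents w \<subseteq> {..length w}" "finite (descents w)"
  by (auto simp: descents_def)

text \<open>A run of a new greatest letter is entered by an ascent and left by exactly one descent,
  which replaces whatever happened at index \<open>p\<close>.\<close>

lemma card_descents_insert_run:
  assumes p: "p \<le> length w" and k: "k \<ge> 1" and a: "\<And>x. x \<in> set w \<Longrightarrow> x < a"
  shows "card (descents (insert_run k a p w))
           = card (descents w) + (if p \<in> descents w then 0 else 1)"
proof -
  let ?u = "take p w" and ?v = "drop p w" and ?r = "replicate k a"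
  have rne: "?r \<noteq> []" "hd ?r = a" "last ?r = a" using k by (auto simp: hd_replicate)
  have lastu: "last ?u < a" if "?u \<noteq> []"
    using a[of "last ?u"] last_in_set[OF that] by (auto dest: in_set_takeD)
  have hdv: "hd ?v < a" if "?v \<noteq> []"
    using a[of "hd ?v"] hd_in_set[OF that] by (auto dest: in_set_dropD)
  have "card (descents (?r @ ?v)) = 1 + card (descents ?v)"
  proof (cases "?v = []")
    case True
    then show ?thesis using card_descents_replicate[OF k] by (simp add: card_descents_Nil)
  next
    case False
    then show ?thesis
      using card_descents_append[OF False, of ?r] hdv[OF False] rne card_descents_replicate[OF k]
      by simp
  qed
  moreover have "card (descents (?u @ ?r @ ?v)) + (if ?u \<noteq> [] then 1 else 0)
      = card (descents ?u) + card (descents (?r @ ?v))"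
    using card_descents_append[of "?r @ ?v" ?u] rne lastu by (auto simp: less_imp_le)
  ultimately have ins: "card (descents (insert_run k a p w)) + (if ?u \<noteq> [] then 1 else 0)
      = card (descents ?u) + card (descents ?v) + 1"
    by (simp add: insert_run_def)
  show ?thesis
  proof (cases "?v = []")
    case True
    with p have pl: "p = length w" by simp
    \<comment> \<open>The final index counts by convention, but the empty word has no index at all,
      so there the count grows from 0 to 1.\<close>
    then have "p \<in> descents w \<longleftrightarrow> w \<noteq> []" by (auto simp: descents_def Suc_le_eq)
    with ins pl show ?thesis by (auto simp: card_descents_Nil)
  next
    case False
    then have pl: "p < length w" by simp
    then have hd: "hd ?v = w ! p" by (simp add: hd_drop_conv_nth)
    have last: "last ?u = w ! (p - 1)" if "p > 0"
      using that pl by (subst last_conv_nth) (auto simp: min_def)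
    have D: "p \<in> descents w \<longleftrightarrow> p > 0 \<and> last ?u > hd ?v"
      using pl last hd by (auto simp: descents_def Suc_le_eq)
    have U: "?u \<noteq> [] \<longleftrightarrow> p > 0" using pl by auto
    have "card (descents w) + (if p > 0 \<and> last ?u \<le> hd ?v then 1 else 0)
        = card (descents ?u) + card (descents ?v)"
      using card_descents_append[OF False, of ?u] unfolding U append_take_drop_id .
    \<comment> \<open>Pure arithmetic that eliminates \<open>z\<close>, the sum of the descents of
      the two pieces.\<close>
    moreover have "x = y + (if P \<and> c < b then 0 else 1)"
      if "x + (if P then 1 else 0) = z + 1" "y + (if P \<and> b \<le> c then 1 else 0) = z"
      for x y z b c :: nat and P
      using that by (auto split: if_splits)
    ultimately show ?thesis unfolding D using ins[unfolded U] by blast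
  qed
qed

subsection \<open>Stirling permutations\<close>

text \<open>The run is contiguous and its letter is greatest, so it neither violates the Stirling
  condition nor hides a violation among the old letters.\<close>

lemma insert_run_in_stirling_perms_iff:
  assumes p: "p \<le> length w" and k: "k \<ge> 1" and a: "Suc (length ks) \<notin> set w"
  shows "insert_run k (Suc (length ks)) p w \<in> stirling_perms (ks @ [k]) \<longleftrightarrow> w \<in> stirling_perms ks"
proof -
  let ?L = "Suc (length ks)"
  let ?w = "insert_run k ?L p w"
  have set: "set ?w \<subseteq> {1..length (ks @ [k])} \<longleftrightarrow> set w \<subseteq> {1..length ks}"
  proof -
    have "{1..length (ks @ [k])} = insert ?L {1..length ks}" by auto
    then show ?thesis using k a by (auto simp: set_insert_run)
  qed
  have cnt: "(\<forall>i\<in>{1..length (ks @ [k])}. count_list ?w i = (ks @ [k]) ! (i - 1)) \<longleftrightarrow>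
      (\<forall>i\<in>{1..length ks}. count_list w i = ks ! (i - 1))"
  proof -
    have eq: "{1..length (ks @ [k])} = insert ?L {1..length ks}" by auto
    have top: "count_list ?w ?L = (ks @ [k]) ! (?L - 1)"
      using a by (simp add: count_list_insert_run count_notin)
    have rest: "count_list ?w i = count_list w i \<and> (ks @ [k]) ! (i - 1) = ks ! (i - 1)"
      if "i \<in> {1..length ks}" for i
      using that by (auto simp: count_list_insert_run nth_append)
    show ?thesis unfolding eq ball_simps(7) using top rest by simp
  qed
  have st: "(\<forall>i s j. i < s \<and> s < j \<and> j < length ?w \<and> ?w ! i = ?w ! j \<longrightarrow> ?w ! i \<le> ?w ! s) \<longleftrightarrow>
      (\<forall>i s j. i < s \<and> s < j \<and> j < length w \<and> w ! i = w ! j \<longrightarrow> w ! i \<le> w ! s)"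
    (is "?S' \<longleftrightarrow> ?S") if sw: "set w \<subseteq> {1..length ks}"
  proof
    assume S': ?S'
    show ?S
    proof (intro allI impI, elim conjE)
      fix i s j assume *: "i < s" "s < j" "j < length w" "w ! i = w ! j"
      \<comment> \<open>\<open>?f\<close> sends a position of \<open>w\<close> to the position of
        the same letter after insertion; \<open>?g\<close> below undoes this off the run.\<close>
      let ?f = "\<lambda>i. if i < p then i else i + k"
      have f: "?w ! ?f i = w ! i" if "i < length w" for i using p that by (simp add: nth_insert_run)
      have "?f i < ?f s" "?f s < ?f j" "?f j < length ?w"
        using * by (auto simp: length_insert_run)
      with S' have "?w ! ?f i = ?w ! ?f j \<longrightarrow> ?w ! ?f i \<le> ?w ! ?f s" by blast
      then show "w ! i \<le> w ! s" using * f[of i] f[of s] f[of j] by simp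
    qed
  next
    assume S: ?S
    show ?S'
    proof (intro allI impI, elim conjE)
      fix i s j assume *: "i < s" "s < j" "j < length ?w" "?w ! i = ?w ! j"
      let ?in = "\<lambda>i. p \<le> i \<and> i < p + k"
      let ?g = "\<lambda>i. if i < p then i else i - k"
      have lt: "?w ! i < ?L" if "\<not> ?in i" "i < length ?w" for i
      proof -
        have "?w ! i \<in> set w" using that p by (auto simp: nth_insert_run length_insert_run)
        with sw show ?thesis by (auto simp: less_Suc_eq_le)
      qed
      have L: "?w ! i = ?L" if "?in i" for i
        using that p nth_insert_run[OF p, of i k ?L] by simp
      have g: "?w ! i = w ! ?g i" if "\<not> ?in i" "i < length ?w" for i
        using that p by (simp add: nth_insert_run length_insert_run)
      show "?w ! i \<le> ?w ! s"
      proof (cases "?in s")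
        case True
        then show ?thesis using L[OF True] L[of i] lt[of i] * by (cases "?in i") auto
      next
        case False
        \<comment> \<open>If one of the two equal letters were in the run, both would be, and then
          so would \<open>s\<close> between them.\<close>
        have nin: "\<not> ?in i" "\<not> ?in j"
          using False * L[of i] L[of j] lt[of i] lt[of j] by auto
        have "?g i < ?g s" "?g s < ?g j" "?g j < length w"
          using nin False * p by (auto simp: length_insert_run)
        moreover have gi: "?w ! i = w ! ?g i" and gs: "?w ! s = w ! ?g s" and "?w ! j = w ! ?g j"
          using * by (intro g nin False; simp)+
        moreover from this have "w ! ?g i = w ! ?g j" using * by simp
        ultimately have "w ! ?g i \<le> w ! ?g s" using S by blast
        then show ?thesis unfolding gi gs .
      qed
    qed
  qed
  show ?thesis
  proof (cases "set w \<subseteq> {1..length ks}")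
    case True
    show ?thesis unfolding stirling_perms_def mem_Collect_eq set cnt st[OF True] ..
  next
    case False
    then show ?thesis unfolding stirling_perms_def mem_Collect_eq set by simp
  qed
qed

text \<open>Nothing smaller may stand between two copies of the greatest letter, so its copies are
  contiguous.\<close>

lemma stirling_perms_snoc_obtains_run:
  assumes w: "w \<in> stirling_perms (ks @ [k])" and k: "k \<ge> 1"
  obtains p v where "p \<le> length v" "Suc (length ks) \<notin> set v"
    "w = insert_run k (Suc (length ks)) p v"
proof -
  let ?L = "Suc (length ks)"
  define u where "u = takeWhile (\<lambda>x. x \<noteq> ?L) w"
  define y where "y = dropWhile (\<lambda>x. x \<noteq> ?L) w"
  define r where "r = takeWhile (\<lambda>x. x = ?L) y"
  define v where "v = dropWhile (\<lambda>x. x = ?L) y"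
  define n where "n = length r"
  have "\<forall>x\<in>set r. x = ?L" unfolding r_def by (auto dest: set_takeWhileD)
  then have r: "r = replicate n ?L" unfolding n_def by (simp add: replicate_length_same)
  have "w = u @ r @ v" by (simp add: u_def y_def r_def v_def)
  then have weq: "w = u @ replicate n ?L @ v" unfolding r .
  have u: "?L \<notin> set u" unfolding u_def by (auto dest: set_takeWhileD)
  have cnt: "count_list w ?L = k" using w by (auto simp: stirling_perms_def)
  then have "?L \<in> set w" using k count_notin[of ?L w] by fastforce
  then have "y \<noteq> []" unfolding y_def by (auto simp: dropWhile_eq_Nil_conv)
  moreover from this have "hd y = ?L"
    unfolding y_def using hd_dropWhile[of "\<lambda>x. x \<noteq> ?L" w] by blast
  ultimately have rpos: "n > 0" unfolding n_def r_def by (cases y) auto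
  have v: "?L \<notin> set v"
  proof
    assume Lv: "?L \<in> set v"
    then have vne: "v \<noteq> []" by auto
    then have "hd v \<noteq> ?L" unfolding v_def using hd_dropWhile[of "\<lambda>x. x = ?L" y] by blast
    with vne have hdv: "v ! 0 \<noteq> ?L" by (simp add: hd_conv_nth)
    from Lv obtain j where j: "j < length v" "v ! j = ?L" unfolding in_set_conv_nth by blast
    with hdv have "j > 0" by (cases j) auto
    \<comment> \<open>A violation of the Stirling condition: the first copy, the smaller letter
      right after the first run, and a later copy.\<close>
    let ?i = "length u" and ?s = "length u + n" and ?j = "length u + n + j"
    have "?i < ?s" "?s < ?j" "?j < length w" using rpos \<open>j > 0\<close> j weq by auto
    moreover have wi: "w ! ?i = ?L" using rpos by (simp add: weq nth_append)
    moreover have "w ! ?j = ?L" using j by (simp add: weq nth_append)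
    moreover have "\<forall>i s j. i < s \<and> s < j \<and> j < length w \<and> w ! i = w ! j \<longrightarrow> w ! i \<le> w ! s"
      using w unfolding stirling_perms_def by blast
    ultimately have "w ! ?i \<le> w ! ?s" by metis
    then have "?L \<le> v ! 0" unfolding wi by (simp add: weq nth_append)
    moreover have "v ! 0 \<in> set w" using vne weq by auto
    then have "v ! 0 \<le> ?L" using w by (auto simp: stirling_perms_def)
    ultimately show False using hdv by simp
  qed
  have eq: "w = insert_run n ?L (length u) (u @ v)" by (simp add: insert_run_def weq)
  then have "k = n" using cnt u v by (simp add: count_list_insert_run count_notin)
  with eq show thesis using that[of "length u" "u @ v"] u v by simp
qed

lemma stirling_perms_snoc:
  assumes k: "k \<ge> 1"
  shows "bij_betw (\<lambda>(w, p). insert_run k (Suc (length ks)) p w)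
           (SIGMA w:stirling_perms ks. {..length w}) (stirling_perms (ks @ [k]))"
proof -
  let ?L = "Suc (length ks)"
  let ?D = "SIGMA w:stirling_perms ks. {..length w}"
  let ?F = "\<lambda>(w, p). insert_run k ?L p w"
  have L: "?L \<notin> set w" if "w \<in> stirling_perms ks" for w
    using that by (auto simp: stirling_perms_def)
  have "inj_on ?F ?D"
  \<comment> \<open>The inverse deletes the new letter and measures the prefix before its first
    occurrence.\<close>
  proof (rule inj_on_inverseI[where g = "\<lambda>w. (filter (\<lambda>x. x \<noteq> ?L) w, length (takeWhile (\<lambda>x. x \<noteq> ?L) w))"])
    fix wp assume "wp \<in> ?D"
    then obtain w p where wp: "wp = (w, p)" "w \<in> stirling_perms ks" "p \<le> length w" by auto
    have "filter (\<lambda>x. x \<noteq> ?L) (take p w) = take p w" "filter (\<lambda>x. x \<noteq> ?L) (drop p w) = drop p w"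
      using L[OF wp(2)] by (auto simp: filter_id_conv dest: in_set_takeD in_set_dropD)
    then have "filter (\<lambda>x. x \<noteq> ?L) (?F wp) = w" by (simp add: wp insert_run_def)
    moreover have "takeWhile (\<lambda>x. x \<noteq> ?L) (?F wp) = take p w"
    proof -
      obtain k' where "k = Suc k'" using k by (cases k) auto
      moreover have "\<forall>x\<in>set (take p w). x \<noteq> ?L" using L[OF wp(2)] by (auto dest: in_set_takeD)
      ultimately show ?thesis by (simp add: wp insert_run_def takeWhile_append2)
    qed
    ultimately show "(filter (\<lambda>x. x \<noteq> ?L) (?F wp), length (takeWhile (\<lambda>x. x \<noteq> ?L) (?F wp))) = wp"
      using wp by simp
  qed
  moreover have "?F ` ?D = stirling_perms (ks @ [k])"
  proof (intro equalityI subsetI)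
    fix w assume "w \<in> ?F ` ?D"
    then show "w \<in> stirling_perms (ks @ [k])"
      using insert_run_in_stirling_perms_iff[OF _ k L] by auto
  next
    fix w assume w: "w \<in> stirling_perms (ks @ [k])"
    obtain p v where pv: "p \<le> length v" "?L \<notin> set v" "w = insert_run k ?L p v"
      by (rule stirling_perms_snoc_obtains_run[OF w k])
    then have "v \<in> stirling_perms ks" using insert_run_in_stirling_perms_iff[OF pv(1) k pv(2)] w by simp
    with pv show "w \<in> ?F ` ?D" by force
  qed
  ultimately show ?thesis by (simp add: bij_betw_def)
qed

lemma stirling_perms_Nil: "stirling_perms [] = {[]}"
  by (auto simp: stirling_perms_def)

lemma stirling_perms_basic:
  assumes "\<forall>k\<in>set ks. k \<ge> 1"
  shows "finite (stirling_perms ks)"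
    and "w \<in> stirling_perms ks \<Longrightarrow> length w = sum_list ks"
    and "w \<in> stirling_perms ks \<Longrightarrow> card (descents w) \<le> length ks"
proof -
  have "finite (stirling_perms ks) \<and>
    (\<forall>w\<in>stirling_perms ks. length w = sum_list ks \<and> card (descents w) \<le> length ks)"
    using assms
  proof (induction ks rule: rev_induct)
    case Nil
    show ?case by (simp add: stirling_perms_Nil card_descents_Nil)
  next
    case (snoc k ks)
    then have k: "k \<ge> 1" by simp
    let ?D = "SIGMA w:stirling_perms ks. {..length w}"
    let ?F = "\<lambda>(w, p). insert_run k (Suc (length ks)) p w"
    have im: "stirling_perms (ks @ [k]) = ?F ` ?D"
      using stirling_perms_snoc[OF k] by (simp add: bij_betw_def)
    have "finite ?D" using snoc by auto
    moreover have "length w = sum_list (ks @ [k]) \<and> card (descents w) \<le> length (ks @ [k])"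
      if "w \<in> ?F ` ?D" for w
    proof -
      from that obtain v p where v: "v \<in> stirling_perms ks" "p \<le> length v"
        "w = insert_run k (Suc (length ks)) p v" by auto
      have "x < Suc (length ks)" if "x \<in> set v" for x
        using v(1) that by (auto simp: stirling_perms_def less_Suc_eq_le)
      then have "card (descents w) \<le> card (descents v) + 1"
        using card_descents_insert_run[OF v(2) k, of "Suc (length ks)"] v(3) by simp
      moreover have "length w = length v + k" by (simp add: v length_insert_run)
      ultimately show ?thesis using snoc v(1) by auto
    qed
    ultimately show ?case unfolding im by blast
  qed
  then show "finite (stirling_perms ks)"
    "w \<in> stirling_perms ks \<Longrightarrow> length w = sum_list ks"
    "w \<in> stirling_perms ks \<Longrightarrow> card (descents w) \<le> length ks" by auto
qed

text \<open>Of the \<open>K + 1\<close> gaps of a word with \<open>d\<close> descents,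
  \<open>d\<close> keep the count and \<open>K + 1 - d\<close> raise it by one. The weight
  \<open>f\<close> is arbitrary so that both numerators are covered.\<close>

lemma sum_descents_snoc:
  fixes f :: "nat \<Rightarrow> 'a::comm_semiring_1"
  assumes ks: "\<forall>k\<in>set ks. k \<ge> 1" and k: "k \<ge> 1"
  shows "(\<Sum>w\<in>stirling_perms (ks @ [k]). f (card (descents w))) =
    (\<Sum>w\<in>stirling_perms ks. of_nat (card (descents w)) * f (card (descents w))
       + of_nat (sum_list ks + 1 - card (descents w)) * f (card (descents w) + 1))"
proof -
  let ?d = "\<lambda>w. card (descents w)"
  let ?L = "Suc (length ks)"
  have "(\<Sum>w\<in>stirling_perms (ks @ [k]). f (?d w)) =
      (\<Sum>wp\<in>(SIGMA w:stirling_perms ks. {..length w}).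
         f (?d (case wp of (w, p) \<Rightarrow> insert_run k ?L p w)))"
    by (rule sum.reindex_bij_betw[OF stirling_perms_snoc[OF k], symmetric])
  also have "\<dots> = (\<Sum>w\<in>stirling_perms ks. \<Sum>p\<le>length w. f (?d (insert_run k ?L p w)))"
    using stirling_perms_basic(1)[OF ks] by (subst sum.Sigma) (auto intro!: sum.cong)
  also have "\<dots> = (\<Sum>w\<in>stirling_perms ks. of_nat (?d w) * f (?d w)
       + of_nat (sum_list ks + 1 - ?d w) * f (?d w + 1))"
  proof (rule sum.cong[OF refl])
    fix w assume w: "w \<in> stirling_perms ks"
    note [simp] = descents_subset(2)
    have lt: "x < ?L" if "x \<in> set w" for x
      using w that by (auto simp: stirling_perms_def less_Suc_eq_le)
    have "(\<Sum>p\<le>length w. f (?d (insert_run k ?L p w)))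
        = (\<Sum>p\<le>length w. f (?d w + (if p \<in> descents w then 0 else 1)))"
      using card_descents_insert_run[OF _ k lt] by (intro sum.cong) auto
    also have "\<dots> = (\<Sum>p\<in>descents w. f (?d w)) + (\<Sum>p\<in>{..length w} - descents w. f (?d w + 1))"
      by (subst sum.subset_diff[OF descents_subset(1)]) (auto simp: add.commute)
    also have "\<dots> = of_nat (?d w) * f (?d w) + of_nat (sum_list ks + 1 - ?d w) * f (?d w + 1)"
      using descents_subset(1)[of w] stirling_perms_basic(2)[OF ks w] by (simp add: card_Diff_subset)
    finally show "(\<Sum>p\<le>length w. f (?d (insert_run k ?L p w))) =
      of_nat (?d w) * f (?d w) + of_nat (sum_list ks + 1 - ?d w) * f (?d w + 1)" .
  qed
  finally show ?thesis .
qed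

subsection \<open>Generating functions of the Stirling polynomials\<close>

definition descent_fps :: "nat list \<Rightarrow> rat fps" where
  "descent_fps ks = (\<Sum>w\<in>stirling_perms ks. fps_X ^ card (descents w))"

text \<open>For the empty tuple this is \<open>fps_X\<close>, so \<open>b_fps []\<close> vanishes at
  0 although \<open>stirling_poly_b []\<close> is 1 there.\<close>

definition codescent_fps :: "nat list \<Rightarrow> rat fps" where
  "codescent_fps ks = (\<Sum>w\<in>stirling_perms ks. fps_X ^ (sum_list ks + 1 - card (descents w)))"

lemma fps_X_times_deriv_power:
  "fps_X * fps_deriv (fps_X ^ n) = of_nat n * (fps_X ^ n :: 'a::comm_ring_1 fps)"
proof (induction n)
  case (Suc n)
  have "fps_X * fps_deriv (fps_X ^ Suc n :: 'a fps) = fps_X ^ Suc n + fps_X * (fps_X * fps_deriv (fps_X ^ n))"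
    by (simp only: power_Suc fps_deriv_mult fps_deriv_fps_X) (simp only: algebra_simps mult_1_left)
  then show ?case unfolding Suc by (simp add: algebra_simps)
qed simp

text \<open>The operator on numerators that corresponds to \<open>x d/dx\<close> after division by
  \<open>(1 - x)\<^bsup>K + 1\<^esup>\<close>.\<close>
definition euler_numerator :: "nat \<Rightarrow> rat fps \<Rightarrow> rat fps" where
  "euler_numerator K P = of_nat (K + 1) * fps_X * P + (1 - fps_X) * (fps_X * fps_deriv P)"

lemma euler_numerator_sum:
  "euler_numerator K (\<Sum>x\<in>A. f x) = (\<Sum>x\<in>A. euler_numerator K (f x))"
  by (simp add: euler_numerator_def fps_deriv_sum sum_distrib_left sum.distrib)

text \<open>The coefficients \<open>d\<close> and \<open>K + 1 - d\<close> are the gap counts of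
  \<open>sum_descents_snoc\<close>, which identifies the operator with insertion of a run.\<close>

lemma euler_numerator_power:
  assumes "d \<le> K + 1"
  shows "euler_numerator K (fps_X ^ d) = of_nat d * fps_X ^ d + of_nat (K + 1 - d) * fps_X ^ (d + 1)"
  using assms unfolding euler_numerator_def fps_X_times_deriv_power
  by (simp add: of_nat_diff algebra_simps)

lemma descent_fps_snoc:
  assumes ks: "\<forall>k\<in>set ks. k \<ge> 1" and k: "k \<ge> 1"
  shows "descent_fps (ks @ [k]) = euler_numerator (sum_list ks) (descent_fps ks)"
  unfolding descent_fps_def euler_numerator_sum
  unfolding sum_descents_snoc[OF ks k, of "\<lambda>d. fps_X ^ d"]
proof (rule sum.cong[OF refl])
  fix w assume w: "w \<in> stirling_perms ks"
  have "length ks \<le> sum_list ks" using ks by (induction ks) auto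
  then have "card (descents w) \<le> sum_list ks + 1" using stirling_perms_basic(3)[OF ks w] by simp
  then show "of_nat (card (descents w)) * fps_X ^ card (descents w) +
      of_nat (sum_list ks + 1 - card (descents w)) * fps_X ^ (card (descents w) + 1) =
      euler_numerator (sum_list ks) (fps_X ^ card (descents w))"
    by (simp only: euler_numerator_power)
qed

text \<open>With \<open>e = K + 1 - d\<close> the two kinds of gaps exchange roles, and the
  \<open>Suc c\<close> new letters leave an additional shift by \<open>c\<close>.\<close>

lemma codescent_fps_snoc:
  assumes ks: "\<forall>k\<in>set ks. k \<ge> 1"
  shows "codescent_fps (ks @ [Suc c]) = fps_X ^ c * euler_numerator (sum_list ks) (codescent_fps ks)"
proof -
  let ?K = "sum_list ks" and ?d = "\<lambda>w. card (descents w)"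
  have "codescent_fps (ks @ [Suc c]) = (\<Sum>w\<in>stirling_perms (ks @ [Suc c]). fps_X ^ (?K + c + 2 - ?d w))"
    by (simp add: codescent_fps_def)
  also have "\<dots> = (\<Sum>w\<in>stirling_perms ks. of_nat (?d w) * fps_X ^ (?K + c + 2 - ?d w)
      + of_nat (?K + 1 - ?d w) * fps_X ^ (?K + c + 2 - (?d w + 1)))"
    by (rule sum_descents_snoc[OF ks]) simp
  also have "\<dots> = (\<Sum>w\<in>stirling_perms ks. fps_X ^ c * euler_numerator ?K (fps_X ^ (?K + 1 - ?d w)))"
  proof (rule sum.cong[OF refl])
    fix w assume w: "w \<in> stirling_perms ks"
    have "length ks \<le> ?K" using ks by (induction ks) auto
    then have d: "?d w \<le> ?K" using stirling_perms_basic(3)[OF ks w] by simp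
    define e where "e = ?K + 1 - ?d w"
    have e: "e \<le> ?K + 1" "?d w = ?K + 1 - e" using d by (auto simp: e_def)
    have exps: "?K + c + 2 - ?d w = c + (e + 1)" "?K + c + 2 - (?d w + 1) = c + e"
      using d by (auto simp: e_def)
    show "of_nat (?d w) * fps_X ^ (?K + c + 2 - ?d w)
        + of_nat (?K + 1 - ?d w) * fps_X ^ (?K + c + 2 - (?d w + 1))
        = fps_X ^ c * euler_numerator ?K (fps_X ^ (?K + 1 - ?d w))"
      unfolding exps e_def[symmetric] euler_numerator_power[OF e(1)] e(2)[symmetric] power_add
      by (simp add: algebra_simps)
  qed
  also have "\<dots> = fps_X ^ c * euler_numerator ?K (codescent_fps ks)"
    unfolding codescent_fps_def euler_numerator_sum sum_distrib_left ..
  finally show ?thesis .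
qed

section \<open>From numerators to quotients by powers of 1 - x\<close>

lemma one_minus_fps_X_power_nz: "(1 - fps_X :: rat fps) ^ n \<noteq> 0"
proof -
  have "fps_nth (1 - fps_X :: rat fps) 0 = 1" by simp
  then have "1 - fps_X \<noteq> (0 :: rat fps)" by (metis fps_zero_nth zero_neq_one)
  then show ?thesis by (rule power_not_zero)
qed

lemma eq_divide_one_minus_fps_X_iff:
  "G = P / (1 - fps_X :: rat fps) ^ n \<longleftrightarrow> G * (1 - fps_X) ^ n = P"
proof -
  have "fps_nth ((1 - fps_X :: rat fps) ^ n) 0 \<noteq> 0" by (simp add: fps_power_zeroth)
  then have "is_unit ((1 - fps_X :: rat fps) ^ n)" by simp
  then show ?thesis by (metis dvd_div_mult_self nonzero_mult_div_cancel_right one_minus_fps_X_power_nz unit_imp_dvd)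
qed

text \<open>Differentiate \<open>P = G * (1 - fps_X) ^ (K + 1)\<close>. The result is kept as a
  product, so that later factors can be cancelled.\<close>

lemma euler_numerator_divide:
  assumes "G = P / (1 - fps_X) ^ (K + 1)"
  shows "(fps_X * fps_deriv G) * (1 - fps_X) ^ (K + 2) = euler_numerator K P"
proof -
  have P: "P = G * (1 - fps_X) ^ (K + 1)" using assms unfolding eq_divide_one_minus_fps_X_iff by simp
  have dP: "fps_deriv P = fps_deriv G * (1 - fps_X) ^ (K + 1) - of_nat (K + 1) * G * (1 - fps_X) ^ K"
    by (simp only: P fps_deriv_mult fps_deriv_power' fps_deriv_sub fps_deriv_fps_X fps_deriv_1
        add_diff_cancel_right') (simp add: algebra_simps)
  show ?thesis unfolding euler_numerator_def dP unfolding P by (simp add: algebra_simps)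
qed

definition B_fps :: "nat list \<Rightarrow> rat fps" where
  "B_fps ks = descent_fps ks / (1 - fps_X) ^ (sum_list ks + 1)"

definition b_fps :: "nat list \<Rightarrow> rat fps" where
  "b_fps ks = codescent_fps ks / (1 - fps_X) ^ (sum_list ks + 1)"

text \<open>The denominator exponent grows by \<open>Suc c\<close>; the derivative absorbs one
  factor and \<open>c\<close> factors remain.\<close>

lemma B_fps_snoc:
  assumes "\<forall>k\<in>set ks. k \<ge> 1"
  shows "B_fps (ks @ [Suc c]) * (1 - fps_X) ^ c = fps_X * fps_deriv (B_fps ks)"
proof -
  let ?K = "sum_list ks"
  have "B_fps (ks @ [Suc c]) * (1 - fps_X) ^ (?K + Suc c + 1) = descent_fps (ks @ [Suc c])"
    using eq_divide_one_minus_fps_X_iff[THEN iffD1, OF B_fps_def[of "ks @ [Suc c]"]] by simp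
  also have "\<dots> = (fps_X * fps_deriv (B_fps ks)) * (1 - fps_X) ^ (?K + 2)"
    using euler_numerator_divide[OF B_fps_def[of ks]] descent_fps_snoc[OF assms, of "Suc c"] by simp
  finally have "(B_fps (ks @ [Suc c]) * (1 - fps_X) ^ c) * (1 - fps_X) ^ (?K + 2) =
      (fps_X * fps_deriv (B_fps ks)) * (1 - fps_X) ^ (?K + 2)"
    by (simp add: power_add mult_ac)
  then show ?thesis using one_minus_fps_X_power_nz mult_right_cancel by blast
qed

lemma b_fps_snoc:
  assumes "\<forall>k\<in>set ks. k \<ge> 1"
  shows "b_fps (ks @ [Suc c]) * (1 - fps_X) ^ c = fps_X ^ c * (fps_X * fps_deriv (b_fps ks))"
proof -
  let ?K = "sum_list ks"
  have "b_fps (ks @ [Suc c]) * (1 - fps_X) ^ (?K + Suc c + 1) = codescent_fps (ks @ [Suc c])"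
    using eq_divide_one_minus_fps_X_iff[THEN iffD1, OF b_fps_def[of "ks @ [Suc c]"]] by simp
  also have "\<dots> = fps_X ^ c * ((fps_X * fps_deriv (b_fps ks)) * (1 - fps_X) ^ (?K + 2))"
    unfolding euler_numerator_divide[OF b_fps_def[of ks]] codescent_fps_snoc[OF assms] ..
  finally have "(b_fps (ks @ [Suc c]) * (1 - fps_X) ^ c) * (1 - fps_X) ^ (?K + 2) =
      (fps_X ^ c * (fps_X * fps_deriv (b_fps ks))) * (1 - fps_X) ^ (?K + 2)"
    by (simp add: power_add mult_ac)
  then show ?thesis using one_minus_fps_X_power_nz mult_right_cancel by blast
qed

section \<open>Coefficient recursions for block tuples\<close>

lemma fps_X_times_deriv_nth: "fps_nth (fps_X * fps_deriv G) m = of_nat m * fps_nth G (m::nat)"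
  by (cases m) simp_all

lemma fps_mult_one_minus_X_nth:
  fixes G :: "'a::comm_ring_1 fps"
  shows "fps_nth (G * (1 - fps_X)) 0 = fps_nth G 0"
    and "fps_nth (G * (1 - fps_X)) (Suc m) = fps_nth G (Suc m) - fps_nth G m"
  by (simp_all add: algebra_simps)

lemma fps_nth_append_ones:
  assumes "\<forall>k\<in>set ks. k \<ge> 1"
  shows "fps_nth (B_fps (ks @ replicate r 1)) m = of_nat m ^ r * fps_nth (B_fps ks) m"
    and "fps_nth (b_fps (ks @ replicate r 1)) m = of_nat m ^ r * fps_nth (b_fps ks) m"
proof (induction r)
  case (Suc r)
  have eq: "ks @ replicate (Suc r) 1 = (ks @ replicate r 1) @ [Suc 0]"
    by (simp add: replicate_append_same)
  have pos: "\<forall>k\<in>set (ks @ replicate r 1). k \<ge> 1" using assms by auto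
  {
    case 1
    show ?case
      using B_fps_snoc[OF pos, of 0] Suc(1) unfolding eq
      by (simp add: fps_X_times_deriv_nth mult.assoc del: append_assoc)
  next
    case 2
    show ?case
      using b_fps_snoc[OF pos, of 0] Suc(2) unfolding eq
      by (simp add: fps_X_times_deriv_nth mult.assoc del: append_assoc)
  }
qed simp_all

lemma block_tuple_Suc: "block_tuple t (Suc n) = (block_tuple t n @ replicate (t - 1) 1) @ [Suc 1]"
proof -
  have "replicate (Suc n) x = replicate n x @ [x]" for x :: "nat list"
    by (simp add: replicate_append_same)
  then show ?thesis unfolding block_tuple_def by (simp add: numeral_2_eq_2)
qed

lemma block_tuple_pos: "\<forall>k\<in>set (block_tuple t n). k \<ge> 1"
  by (auto simp: block_tuple_def)

text \<open>The \<open>t - 1\<close> ones multiply the coefficient at \<open>m\<close> by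
  \<open>m ^ (t - 1)\<close>. The final 2 gives one more factor \<open>m\<close> and a factor
  \<open>1 - fps_X\<close>, that is, a difference of neighbouring coefficients.\<close>

lemma block_tuple_recursion:
  assumes t: "t \<ge> 1"
  shows "fps_nth (B_fps (block_tuple t (Suc n))) 0 = 0"
    and "fps_nth (B_fps (block_tuple t (Suc n))) (Suc m) =
           fps_nth (B_fps (block_tuple t (Suc n))) m + of_nat (Suc m) ^ t * fps_nth (B_fps (block_tuple t n)) (Suc m)"
    and "fps_nth (b_fps (block_tuple t (Suc n))) 0 = 0"
    and "fps_nth (b_fps (block_tuple t (Suc n))) (Suc m) =
           fps_nth (b_fps (block_tuple t (Suc n))) m + of_nat m ^ t * fps_nth (b_fps (block_tuple t n)) m"
proof -
  let ?ks = "block_tuple t n @ replicate (t - 1) 1"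
  have pos: "\<forall>k\<in>set ?ks. k \<ge> 1" using block_tuple_pos by auto
  have pw: "x ^ t = x * x ^ (t - 1)" for x :: rat using t by (cases t) auto
  note ones = fps_nth_append_ones[OF block_tuple_pos, of t n "t - 1"]
  have B: "fps_nth (B_fps (block_tuple t (Suc n)) * (1 - fps_X)) m
      = of_nat m ^ t * fps_nth (B_fps (block_tuple t n)) m" for m
    by (simp only: block_tuple_Suc B_fps_snoc[OF pos, of 1, unfolded power_one_right]
        fps_X_times_deriv_nth ones pw mult.assoc)
  \<comment> \<open>The additional factor \<open>fps_X\<close> in \<open>b_fps_snoc\<close> moves
    the index to \<open>m - 1\<close>.\<close>
  have b: "fps_nth (b_fps (block_tuple t (Suc n)) * (1 - fps_X)) m
      = (if m = 0 then 0 else of_nat (m - 1) ^ t * fps_nth (b_fps (block_tuple t n)) (m - 1))" for m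
    unfolding block_tuple_Suc b_fps_snoc[OF pos, of 1, unfolded power_one_right]
    by (subst fps_X_mult_nth) (simp only: fps_X_times_deriv_nth ones pw mult.assoc)
  show "fps_nth (B_fps (block_tuple t (Suc n))) 0 = 0"
    using B[of 0] t by (simp add: fps_mult_one_minus_X_nth)
  show "fps_nth (B_fps (block_tuple t (Suc n))) (Suc m) =
      fps_nth (B_fps (block_tuple t (Suc n))) m + of_nat (Suc m) ^ t * fps_nth (B_fps (block_tuple t n)) (Suc m)"
    using B[of "Suc m"] unfolding fps_mult_one_minus_X_nth(2) by (simp add: algebra_simps)
  show "fps_nth (b_fps (block_tuple t (Suc n))) 0 = 0"
    using b[of 0] by (simp add: fps_mult_one_minus_X_nth)
  show "fps_nth (b_fps (block_tuple t (Suc n))) (Suc m) =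
      fps_nth (b_fps (block_tuple t (Suc n))) m + of_nat m ^ t * fps_nth (b_fps (block_tuple t n)) m"
    using b[of "Suc m"] unfolding fps_mult_one_minus_X_nth(2) by (simp add: algebra_simps)
qed

lemma B_fps_Nil: "fps_nth (B_fps []) m = 1"
proof -
  let ?G = "Abs_fps (\<lambda>_. 1) :: rat fps"
  have "fps_nth (?G * (1 - fps_X) ^ (sum_list [] + 1)) i = fps_nth (descent_fps []) i" for i
    by (cases i)
      (simp_all add: fps_mult_one_minus_X_nth descent_fps_def stirling_perms_Nil card_descents_Nil)
  then have "?G = B_fps []"
    unfolding B_fps_def eq_divide_one_minus_fps_X_iff by (intro fps_ext) blast
  from this[symmetric] show ?thesis by simp
qed

lemma b_fps_Nil: "fps_nth (b_fps []) m = (if m = 0 then 0 else 1)"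
proof -
  \<comment> \<open>This is \<open>x / (1 - x)\<close>, because the numerator of the empty tuple is
    \<open>x\<close>.\<close>
  let ?G = "Abs_fps (\<lambda>m. if m = 0 then 0 else 1) :: rat fps"
  have "fps_nth (?G * (1 - fps_X) ^ (sum_list [] + 1)) i = fps_nth (codescent_fps []) i" for i
    by (cases i)
      (simp_all add: fps_mult_one_minus_X_nth codescent_fps_def stirling_perms_Nil card_descents_Nil)
  then have "?G = b_fps []"
    unfolding b_fps_def eq_divide_one_minus_fps_X_iff by (intro fps_ext) blast
  from this[symmetric] show ?thesis by simp
qed

lemma B_fps_block_tuple:
  assumes t: "t \<ge> 1"
  shows "fps_nth (B_fps (block_tuple t n)) m = of_int (gen_stirling2 t (int n + int m) (int m))"
proof (induction n arbitrary: m)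
  case 0
  show ?case using gen_stirling2_column(1) by (simp add: block_tuple_def B_fps_Nil)
next
  case (Suc n)
  note IH = this
  show ?case
  proof (induction m)
    case 0
    show ?case using block_tuple_recursion(1)[OF t] gen_stirling2_column(2)[OF t, of n] by simp
  next
    case (Suc m)
    show ?case
      unfolding block_tuple_recursion(2)[OF t] gen_stirling2_column(3) Suc IH by simp
  qed
qed

text \<open>The case \<open>m = n = 0\<close> is excluded because there the series gives 0 while the
  Stirling number is 1.\<close>

lemma b_fps_block_tuple:
  assumes t: "t \<ge> 1" and "m \<ge> 1 \<or> n \<ge> 1"
  shows "fps_nth (b_fps (block_tuple t n)) m = of_int (gen_stirling1 t (int m) (int m - int n))"
  using assms(2)
proof (induction n arbitrary: m)
  case 0
  then show ?case using gen_stirling1_diag[of t m] by (simp add: block_tuple_def b_fps_Nil)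
next
  case (Suc n)
  note IH = Suc.IH
  show ?case
  proof (induction m)
    case 0
    show ?case using block_tuple_recursion(3)[OF t] by (simp add: gen_stirling1_def)
  next
    case (Suc m)
    have "int (Suc m) - int (Suc n) - 1 = int m - int (Suc n)" "int (Suc m) - int (Suc n) = int m - int n"
      by simp_all
    then have "gen_stirling1 t (int (Suc m)) (int (Suc m) - int (Suc n)) =
        gen_stirling1 t (int m) (int m - int (Suc n)) + int (m ^ t) * gen_stirling1 t (int m) (int m - int n)"
      by (simp only: gen_stirling1_Suc)
    moreover have "of_nat m ^ t * fps_nth (b_fps (block_tuple t n)) m =
        of_int (int (m ^ t) * gen_stirling1 t (int m) (int m - int n))"
      \<comment> \<open>For \<open>m = 0\<close> the induction hypothesis may be missing, but
        \<open>0 ^ t = 0\<close> makes both sides vanish.\<close>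
      using IH[of m] t by (cases "m = 0") auto
    ultimately show ?case unfolding block_tuple_recursion(4)[OF t] Suc by simp
  qed
qed

text \<open>The final index makes every nonempty word have a descent, and there are at most
  \<open>length ks\<close> of them, so grouping words by descents over this range loses
  none.\<close>

lemma sum_eulerian_count:
  assumes ks: "\<forall>k\<in>set ks. k \<ge> 1" "ks \<noteq> []"
  shows "(\<Sum>i=1..length ks. of_nat (eulerian_count ks i) * g i) =
    (\<Sum>w\<in>stirling_perms ks. g (card (descents w)) :: 'a::comm_semiring_1)"
proof -
  note basic = stirling_perms_basic[OF ks(1)]
  have "card (descents w) \<in> {1..length ks}" if w: "w \<in> stirling_perms ks" for w
  proof -
    have "sum_list ks \<noteq> 0" using ks by (cases ks) auto
    then have "length w \<noteq> 0" using basic(2)[OF w] by metis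
    then have "length w \<in> descents w" by (simp add: descents_def Suc_le_eq)
    then have "card (descents w) \<noteq> 0" using descents_subset(2)[of w] by auto
    with basic(3)[OF w] show ?thesis by simp
  qed
  then have "(\<Sum>w\<in>stirling_perms ks. g (card (descents w))) =
      (\<Sum>i=1..length ks. \<Sum>w | w \<in> stirling_perms ks \<and> card (descents w) = i. g (card (descents w)))"
    using basic(1) by (intro sum.group[symmetric]) auto
  also have "\<dots> = (\<Sum>i=1..length ks. of_nat (eulerian_count ks i) * g i)"
    by (rule sum.cong) (auto simp: eulerian_count_def)
  finally show ?thesis ..
qed

lemma stirling_poly_B_eq_nth:
  assumes "\<forall>k\<in>set ks. k \<ge> 1"
  shows "stirling_poly_B ks m = fps_nth (B_fps ks) m"
proof (cases "ks = []")
  case True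
  then show ?thesis by (simp add: stirling_poly_B_def B_fps_Nil)
next
  case False
  then show ?thesis
    unfolding stirling_poly_B_def B_fps_def descent_fps_def sum_eulerian_count[OF assms False] by simp
qed

lemma stirling_poly_b_eq_nth:
  assumes "\<forall>k\<in>set ks. k \<ge> 1" "m \<ge> 1"
  shows "stirling_poly_b ks m = fps_nth (b_fps ks) m"
proof (cases "ks = []")
  case True
  then show ?thesis using assms by (simp add: stirling_poly_b_def b_fps_Nil)
next
  case False
  let ?K = "sum_list ks"
  have le: "length ks \<le> ?K" using assms(1) by (induction ks) auto
  have "(\<Sum>i=?K - length ks + 1..?K. of_nat (eulerian_count ks (?K + 1 - i)) * fps_X ^ i)
      = (\<Sum>i=1..length ks. of_nat (eulerian_count ks i) * fps_X ^ (?K + 1 - i) :: rat fps)"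
    \<comment> \<open>Reflection at \<open>?K + 1\<close> exchanges the two ranges, without
      truncation because \<open>length ks \<le> ?K\<close>.\<close>
    by (rule sum.reindex_bij_witness[of _ "\<lambda>i. ?K + 1 - i" "\<lambda>i. ?K + 1 - i"]) (use le in auto)
  also have "\<dots> = codescent_fps ks"
    unfolding codescent_fps_def sum_eulerian_count[OF assms(1) False] ..
  finally show ?thesis using False unfolding stirling_poly_b_def b_fps_def by simp
qed

theorem theorem5:
  fixes t :: nat
  assumes "t \<ge> 1"
  shows
    "(\<forall>n k :: nat. n \<ge> k \<and> k \<ge> 1 \<longrightarrow>
        gen_stirling2 t (int n) (int k) = int (card (same_min_partitions t n k))) \<and>
     (\<forall>n k :: nat. n \<ge> k \<and> k \<ge> 1 \<longrightarrow>
        gen_stirling1 t (int n) (int k) = int (card (same_min_permutations t n k))) \<and>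
     (\<forall>n m :: nat. m \<ge> 1 \<longrightarrow>
        stirling_poly_B (block_tuple t n) m = of_int (gen_stirling2 t (int n + int m) (int m)) \<and>
        stirling_poly_b (block_tuple t n) m = of_int (gen_stirling1 t (int m) (int m - int n))) \<and>
     (\<forall>n k :: nat. n \<ge> 1 \<and> k \<ge> 1 \<longrightarrow>
        gen_stirling2 t (int n + int k) (int k) =
          (\<Sum>js | length js = n \<and> sorted js \<and> set js \<subseteq> {1..k}.
             \<Prod>j\<leftarrow>js. int j ^ t) \<and>
        gen_stirling1 t (int n) (int n - int k) =
          (\<Sum>js | length js = k \<and> sorted_wrt (<) js \<and> set js \<subseteq> {1..<n}.
             \<Prod>j\<leftarrow>js. int j ^ t))"
proof (intro conjI allI impI; (elim conjE)?)
  fix n k :: nat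
  show "gen_stirling2 t (int n) (int k) = int (card (same_min_partitions t n k))"
    by (simp add: gen_stirling2_eq_triangle card_same_min_partitions[OF assms])
  show "gen_stirling1 t (int n) (int k) = int (card (same_min_permutations t n k))"
    by (simp add: gen_stirling1_eq_triangle card_same_min_permutations[OF assms])
  show "gen_stirling2 t (int n + int k) (int k) =
      (\<Sum>js | length js = n \<and> sorted js \<and> set js \<subseteq> {1..k}. \<Prod>j\<leftarrow>js. int j ^ t)"
    by (rule gen_stirling2_eq_sum_sorted[OF assms])
  show "gen_stirling1 t (int n) (int n - int k) =
      (\<Sum>js | length js = k \<and> sorted_wrt (<) js \<and> set js \<subseteq> {1..<n}. \<Prod>j\<leftarrow>js. int j ^ t)"
    by (rule gen_stirling1_eq_sum_strictly_sorted[OF assms])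
next
  fix n m :: nat
  assume m: "1 \<le> m"
  show "stirling_poly_B (block_tuple t n) m = of_int (gen_stirling2 t (int n + int m) (int m))"
    by (simp only: stirling_poly_B_eq_nth[OF block_tuple_pos] B_fps_block_tuple[OF assms])
  show "stirling_poly_b (block_tuple t n) m = of_int (gen_stirling1 t (int m) (int m - int n))"
    unfolding stirling_poly_b_eq_nth[OF block_tuple_pos m]
    by (rule b_fps_block_tuple[OF assms]) (use m in blast)
qed

end
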